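(* Let $G$ be a strongly balanced connected graph with $v(G)=k\ge2$ vertices and $e(G)$ edges, and let $N_G$ be the number of copies of $G$ in the binomial random-connection model $G_H(\mathcal{X}_n)$ with connection probabilities $p_nH(X_i,X_j)$. Suppose that $$\mathrm{Var}\Big[\sum_{\ell=1}^k f_{(\ell)}(X_1)\Big]>0 .$$ a) If $n^{-(v(G)-1)/e(G)}\ll p_n$, then $$\kappa_2(N_G)\ge\frac{C}{a(G)^2}\,\frac{n!}{(n+1-2v(G))!}\,p_n^{2e(G)},$$ where $C>0$ is a constant independent of $n\ge 2v(G)-1$. b) If $p_n\ll n^{-(v(G)-1)/e(G)}$, then $$\kappa_2(N_G)\ge\frac{C}{a(G)^2}\,\frac{n!}{(n-v(G))!}\,p_n^{e(G)},$$ where $C>0$ is a constant independent of $n\ge 2v(G)-1$.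
   Context: Binomial random-connection model. $X_1,\dots,X_n$ are i.i.d. random points of $\mathbb{R}^d$ with common continuous (atomless) distribution $\mu$, $\mathcal{X}_n=\{X_1,\dots,X_n\}$, $H:\mathbb{R}^d\times\mathbb{R}^d\to[0,1]$ is a symmetric measurable function, and $p_n\in(0,1)$ for each $n$; $\mu$ and $H$ do not depend on $n$. Given $\mathcal{X}_n$, each pair $X_i,X_j$ ($i\ne j$) is connected by an edge (written $X_i\sim X_j$) independently with probability $p_nH(X_i,X_j)$. The resulting random graph is $G_H(\mathcal{X}_n)$. Subgraph count. $G=(V_G,E_G)$ is a simple graph with $v(G)=|V_G|=k$, vertex set identified with $[k]=\{1,\dots,k\}$, $e(G)=|E_G|$, and $a(G)$ is the number of automorphisms of $G$. With $[n]^k_{\neq}:=\{\beta\in[n]^k:\beta(i)\ne\beta(j)\text{ for }i\ne j\}$, $$N_G:=\frac{1}{a(G)}\sum_{\beta\in[n]^k_{\neq}}\ \prod_{\{u,v\}\in E_G}\mathbf{1}_{\{X_{\beta(u)}\sim X_{\beta(v)}\}}.$$ For $1\le\ell\le k$, $$f_{(\ell)}(x):=\frac{p_n^{e(G)}}{a(G)}\int_{(\mathbb{R}^d)^{k-1}}\prod_{\{u,v\}\in E_G}H(x_u,x_v)\,\mu^{\otimes(k-1)}(\mathrm{d}x_1,\dots,\mathrm{d}x_{\ell-1},\mathrm{d}x_{\ell+1},\dots,\mathrm{d}x_k),\qquad x_\ell:=x.$$ Since $p_n\in(0,1)$, the variance condition does not depend on $n$. $G$ is strongly balanced if $\dfrac{e(G')}{v(G')-1}\le\dfrac{e(G)}{v(G)-1}$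 for every subgraph $G'\subset G$ with $v(G')\ge2$. $f(n)\ll g(n)$ means $f(n)\ge0$, $g(n)>0$ and $\lim_{n\to\infty}f(n)/g(n)=0$. $\kappa_2$ denotes the variance. *)

theory Defs
  imports "HOL-Probability.Probability" "HOL-Combinatorics.Permutations" "HOL-Library.Ramsey"
begin

text \<open>A graph is given by its vertex set \<open>V\<close> and its set \<open>E\<close> of edges, which are two-element
  subsets of \<open>V\<close> (\<open>nsets V 2\<close> is the set of all of these).\<close>

definition simple_graph :: "nat set \<Rightarrow> nat set set \<Rightarrow> bool" where
  "simple_graph V E \<longleftrightarrow> finite V \<and> E \<subseteq> nsets V 2"

definition subgraph :: "nat set \<Rightarrow> nat set set \<Rightarrow> nat set \<Rightarrow> nat set set \<Rightarrow> bool" where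
  "subgraph V' E' V E \<longleftrightarrow> simple_graph V' E' \<and> V' \<subseteq> V \<and> E' \<subseteq> E"

definition connected_graph :: "nat set \<Rightarrow> nat set set \<Rightarrow> bool" where
  "connected_graph V E \<longleftrightarrow> (\<forall>u\<in>V. \<forall>v\<in>V. (u, v) \<in> {(x, y). {x, y} \<in> E}\<^sup>*)"

definition strongly_balanced :: "nat set \<Rightarrow> nat set set \<Rightarrow> bool" where
  "strongly_balanced V E \<longleftrightarrow>
     (\<forall>V' E'. subgraph V' E' V E \<and> card V' \<ge> 2 \<longrightarrow>
        real (card E') / (real (card V') - 1) \<le> real (card E) / (real (card V) - 1))"

definition automorphisms :: "nat set \<Rightarrow> nat set set \<Rightarrow> (nat \<Rightarrow> nat) set" where
  "automorphisms V E =
     {\<pi>. \<pi> permutes V \<and> (\<forall>u\<in>V. \<forall>v\<in>V. {\<pi> u, \<pi> v} \<in> E \<longleftrightarrow> {u, v} \<in> E)}"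

text \<open>The value \<open>H (x u) (x v)\<close> at an unordered pair \<open>e = {u, v}\<close>. It is only used for symmetric
  \<open>H\<close>, so that ordering the two end points is immaterial.\<close>

definition on_edge :: "('a \<Rightarrow> 'a \<Rightarrow> real) \<Rightarrow> (nat \<Rightarrow> 'a) \<Rightarrow> nat set \<Rightarrow> real" where
  "on_edge H x e = H (x (Min e)) (x (Max e))"

text \<open>The sigma-algebra generated by \<open>X 1, \<dots>, X n\<close>.\<close>

definition point_algebra ::
    "'w measure \<Rightarrow> nat \<Rightarrow> (nat \<Rightarrow> 'w \<Rightarrow> 'a::topological_space) \<Rightarrow> 'w measure" where
  "point_algebra M n X =
     vimage_algebra (space M) (\<lambda>\<omega>. \<lambda>i\<in>{1..n}. X i \<omega>) (Pi\<^sub>M {1..n} (\<lambda>_. borel))"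

text \<open>The binomial random-connection model with \<open>n\<close> points. The vertices are the indices of the
  points, and \<open>\<Gamma> \<omega>\<close> is the random edge set: \<open>{i, j} \<in> \<Gamma> \<omega>\<close> means that \<open>X i\<close> and \<open>X j\<close> are connected.
  A distribution on Euclidean space is continuous if it has no point masses.\<close>

locale random_connection_model = prob_space M
  for M :: "'w measure" +
  fixes \<mu> :: "(real ^ 'd) measure"
    and H :: "real ^ 'd \<Rightarrow> real ^ 'd \<Rightarrow> real"
    and p :: real
    and n :: nat
    and X :: "nat \<Rightarrow> 'w \<Rightarrow> real ^ 'd"
    and \<Gamma> :: "'w \<Rightarrow> nat set set"
  assumes mu_prob: "prob_space \<mu>"
    and mu_sets: "sets \<mu> = sets borel"
    and mu_continuous: "emeasure \<mu> {x} = 0"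
    and H_measurable: "(\<lambda>(x, y). H x y) \<in> borel_measurable (borel \<Otimes>\<^sub>M borel)"
    and H_sym: "H x y = H y x"
    and H_range: "0 \<le> H x y" "H x y \<le> 1"
    and p_range: "0 < p" "p < 1"
    and X_indep: "indep_vars (\<lambda>_. borel) X {1..n}"
    and X_distr: "i \<in> {1..n} \<Longrightarrow> distr M borel (X i) = \<mu>"
    and edges: "\<omega> \<in> space M \<Longrightarrow> \<Gamma> \<omega> \<subseteq> nsets {1..n} 2"
    and edge_event: "e \<in> nsets {1..n} 2 \<Longrightarrow> {\<omega> \<in> space M. e \<in> \<Gamma> \<omega>} \<in> sets M"
    and edge_cond_prob: "e \<in> nsets {1..n} 2 \<Longrightarrow>
      AE \<omega> in M.
        real_cond_exp M (point_algebra M n X) (indicator {\<omega> \<in> space M. e \<in> \<Gamma> \<omega>}) \<omega>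
        = p * on_edge H (\<lambda>i. X i \<omega>) e"
    and edge_cond_indep: "S \<subseteq> nsets {1..n} 2 \<Longrightarrow>
      AE \<omega> in M.
        real_cond_exp M (point_algebra M n X) (indicator {\<omega> \<in> space M. \<forall>e\<in>S. e \<in> \<Gamma> \<omega>}) \<omega>
        = (\<Prod>e\<in>S. real_cond_exp M (point_algebra M n X) (indicator {\<omega> \<in> space M. e \<in> \<Gamma> \<omega>}) \<omega>)"

text \<open>The number of copies of \<open>(V, E)\<close> in the graph on \<open>{1..n}\<close> with edge set \<open>\<Gamma>\<close>; for an edge
  \<open>e = {u, v}\<close>, the image \<open>\<beta> ` e\<close> is \<open>{\<beta> u, \<beta> v}\<close>.\<close>

definition subgraph_count :: "nat set \<Rightarrow> nat set set \<Rightarrow> nat \<Rightarrow> nat set set \<Rightarrow> real" where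
  "subgraph_count V E n \<Gamma> =
     1 / real (card (automorphisms V E)) *
     (\<Sum>\<beta> \<in> {\<beta> \<in> V \<rightarrow>\<^sub>E {1..n}. inj_on \<beta> V}. \<Prod>e\<in>E. of_bool (\<beta> ` e \<in> \<Gamma>))"

text \<open>The function \<open>f_(l)\<close>: the variable at vertex \<open>l\<close> is set to \<open>x\<close>, all others are integrated out.\<close>

definition vertex_integral ::
    "nat set \<Rightarrow> nat set set \<Rightarrow> 'a measure \<Rightarrow> ('a \<Rightarrow> 'a \<Rightarrow> real) \<Rightarrow> real \<Rightarrow> nat \<Rightarrow> 'a \<Rightarrow> real" where
  "vertex_integral V E \<mu> H p l x =
     p ^ card E / real (card (automorphisms V E)) *
     (\<integral>y. (\<Prod>e\<in>E. on_edge H (y(l := x)) e) \<partial>(Pi\<^sub>M (V - {l}) (\<lambda>_. \<mu>)))"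

text \<open>Sequences are indexed by \<open>n \<ge> 1\<close>; the value at \<open>0\<close> is irrelevant.\<close>

definition much_less :: "(nat \<Rightarrow> real) \<Rightarrow> (nat \<Rightarrow> real) \<Rightarrow> bool" (infix "\<lless>" 50) where
  "f \<lless> g \<longleftrightarrow> (\<forall>n\<ge>1. f n \<ge> 0 \<and> g n > 0) \<and> (\<lambda>n. f n / g n) \<longlonglongrightarrow> 0"

end

theory Submission
  imports Defs
begin

text \<open>Let \<open>a\<close> be the number of automorphisms of the graph, \<open>c = (n - 1)! / (n - k)!\<close> and \<open>W\<close> the
  conditional expectation of \<open>a N\<close> given the points. The law of total variance bounds
  \<open>a\<^sup>2 Var N\<close> from below by \<open>Var W\<close> and by the expected conditional variance. The mean of \<open>W\<close> given
  one point is a constant plus \<open>a c\<close> times the sum of the vertex integrals, so Bessel's inequality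
  for these \<open>n\<close> projections gives a multiple of \<open>n c\<^sup>2 p ^ (2 e)\<close> as a lower bound of \<open>Var W\<close>, which
  is (a). For (b), given the points the indicators of the copies are nonnegatively correlated, hence
  the diagonal terms alone bound the conditional variance, and each of them is in expectation at
  least \<open>(1 - p) p ^ e\<close> times the mean of the product of the \<open>H\<close>, while \<open>p \<longlonglongrightarrow> 0\<close>.\<close>

section \<open>Conditioning on one coordinate of a product probability space\<close>

text \<open>An explicit version of the conditional expectation of \<open>F\<close> given that
  coordinate \<open>i\<close> equals \<open>y\<close>. The integral runs over the remaining
  coordinates, in the same form as in \<open>vertex_integral\<close>, so that the vertex integrals
  become scaled coordinate means.\<close>

definition coordinate_mean ::
    "'a measure \<Rightarrow> 'i set \<Rightarrow> (('i \<Rightarrow> 'a) \<Rightarrow> real) \<Rightarrow> 'i \<Rightarrow> 'a \<Rightarrow> real" where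
  "coordinate_mean M I F i y = (\<integral>x. F (x(i := y)) \<partial>Pi\<^sub>M (I - {i}) (\<lambda>_. M))"

lemma abs_mult_le:
  fixes a b :: real
  assumes "\<bar>a\<bar> \<le> A" "\<bar>b\<bar> \<le> B"
  shows "\<bar>a * b\<bar> \<le> A * B"
  unfolding abs_mult using assms by (rule mult_mono') auto

context prob_space
begin

lemma prob_space_power: "prob_space (Pi\<^sub>M I (\<lambda>_. M))"
  by (rule prob_space_PiM) (rule prob_space_axioms)

lemma product_prob_space_power: "product_prob_space (\<lambda>_. M)"
  by (rule product_prob_spaceI) (rule prob_space_axioms)

text \<open>Joint measurability, in the inserted value and the other coordinates together, is what
  Fubini's theorem asks for.\<close>

lemma measurable_update_power:
  assumes "i \<in> I"
  shows "(\<lambda>(y, x). x(i := y)) \<in> measurable (M \<Otimes>\<^sub>M Pi\<^sub>M (I - {i}) (\<lambda>_. M)) (Pi\<^sub>M I (\<lambda>_. M))"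
proof -
  have "I = (I - {i}) \<union> {i}"
    using assms by blast
  then have "(\<lambda>z. (snd z)(i := fst z))
      \<in> measurable (M \<Otimes>\<^sub>M Pi\<^sub>M (I - {i}) (\<lambda>_. M)) (Pi\<^sub>M I (\<lambda>_. M))"
    by (rule measurable_fun_upd) auto
  then show ?thesis
    by (simp add: split_beta')
qed

lemma update_in_space_power:
  assumes "i \<in> I" "y \<in> space M" "x \<in> space (Pi\<^sub>M (I - {i}) (\<lambda>_. M))"
  shows "x(i := y) \<in> space (Pi\<^sub>M I (\<lambda>_. M))"
  using assms by (auto simp: space_PiM PiE_def extensional_def)

lemma coordinate_mean_measurable [measurable]:
  assumes "i \<in> I" and F: "F \<in> borel_measurable (Pi\<^sub>M I (\<lambda>_. M))"
  shows "coordinate_mean M I F i \<in> borel_measurable M"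
proof -
  interpret P: prob_space "Pi\<^sub>M (I - {i}) (\<lambda>_. M)"
    by (rule prob_space_power)
  have "(\<lambda>(y, x). F (x(i := y))) \<in> borel_measurable (M \<Otimes>\<^sub>M Pi\<^sub>M (I - {i}) (\<lambda>_. M))"
    using measurable_compose[OF measurable_update_power[OF \<open>i \<in> I\<close>] F] by (simp add: split_beta')
  then show ?thesis
    unfolding coordinate_mean_def by (rule P.borel_measurable_lebesgue_integral)
qed

lemma integrable_power_update:
  fixes F :: "('i \<Rightarrow> 'a) \<Rightarrow> real"
  assumes "i \<in> I" "F \<in> borel_measurable (Pi\<^sub>M I (\<lambda>_. M))"
    and B: "\<And>x. x \<in> space (Pi\<^sub>M I (\<lambda>_. M)) \<Longrightarrow> \<bar>F x\<bar> \<le> B"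
    and y: "y \<in> space M"
  shows "integrable (Pi\<^sub>M (I - {i}) (\<lambda>_. M)) (\<lambda>x. F (x(i := y)))"
proof -
  interpret P: prob_space "Pi\<^sub>M (I - {i}) (\<lambda>_. M)"
    by (rule prob_space_power)
  have "I = (I - {i}) \<union> {i}"
    using assms by blast
  then have "(\<lambda>x. x(i := y)) \<in> measurable (Pi\<^sub>M (I - {i}) (\<lambda>_. M)) (Pi\<^sub>M I (\<lambda>_. M))"
    by (rule measurable_fun_upd) (use y in auto)
  then have "(\<lambda>x. F (x(i := y))) \<in> borel_measurable (Pi\<^sub>M (I - {i}) (\<lambda>_. M))"
    using assms(2) by (rule measurable_compose)
  then show ?thesis
    by (intro P.integrable_const_bound[where B = B])
      (auto intro!: AE_I2 B update_in_space_power assms)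
qed

lemma coordinate_mean_bounded:
  assumes "i \<in> I" "F \<in> borel_measurable (Pi\<^sub>M I (\<lambda>_. M))"
    and B: "\<And>x. x \<in> space (Pi\<^sub>M I (\<lambda>_. M)) \<Longrightarrow> \<bar>F x\<bar> \<le> B"
    and y: "y \<in> space M"
  shows "\<bar>coordinate_mean M I F i y\<bar> \<le> B"
proof -
  interpret P: prob_space "Pi\<^sub>M (I - {i}) (\<lambda>_. M)"
    by (rule prob_space_power)
  note int = integrable_power_update[OF assms]
  have "\<bar>coordinate_mean M I F i y\<bar> \<le> (\<integral>x. \<bar>F (x(i := y))\<bar> \<partial>Pi\<^sub>M (I - {i}) (\<lambda>_. M))"
    unfolding coordinate_mean_def by (rule integral_abs_bound)
  also have "\<dots> \<le> (\<integral>x. B \<partial>Pi\<^sub>M (I - {i}) (\<lambda>_. M))"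
    using int by (intro integral_mono B update_in_space_power assms) auto
  finally show ?thesis
    by (simp add: P.prob_space)
qed

lemma integral_power_component:
  assumes "i \<in> I" and f: "f \<in> borel_measurable M"
  shows "(\<integral>x. f (x i) \<partial>Pi\<^sub>M I (\<lambda>_. M)) = (\<integral>y. (f y :: real) \<partial>M)"
proof -
  interpret product_prob_space "\<lambda>_. M" I
    by (rule product_prob_space_power)
  have "(\<integral>y. f y \<partial>M) = (\<integral>y. f y \<partial>distr (Pi\<^sub>M I (\<lambda>_. M)) M (\<lambda>x. x i))"
    using PiM_component[OF \<open>i \<in> I\<close>] by simp
  also have "\<dots> = (\<integral>x. f (x i) \<partial>Pi\<^sub>M I (\<lambda>_. M))"
    using assms by (intro integral_distr) auto
  finally show ?thesis ..
qed

text \<open>The defining property of conditional expectation, with a test function of coordinate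
  \<open>i\<close> alone: once that coordinate is integrated last, the test function leaves the
  inner integral. The bounds are there for integrability.\<close>

lemma integral_mult_component:
  fixes \<phi> :: "'a \<Rightarrow> real"
  assumes "finite I" "i \<in> I"
    and F: "F \<in> borel_measurable (Pi\<^sub>M I (\<lambda>_. M))"
    and B: "\<And>x. x \<in> space (Pi\<^sub>M I (\<lambda>_. M)) \<Longrightarrow> \<bar>F x\<bar> \<le> B"
    and \<phi>: "\<phi> \<in> borel_measurable M"
    and C: "\<And>y. y \<in> space M \<Longrightarrow> \<bar>\<phi> y\<bar> \<le> C"
  shows "(\<integral>x. F x * \<phi> (x i) \<partial>Pi\<^sub>M I (\<lambda>_. M)) = (\<integral>y. coordinate_mean M I F i y * \<phi> y \<partial>M)"
proof -
  let ?J = "I - {i}"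
  interpret PI: prob_space "Pi\<^sub>M I (\<lambda>_. M)"
    by (rule prob_space_power)
  interpret PJ: prob_space "Pi\<^sub>M ?J (\<lambda>_. M)"
    by (rule prob_space_power)
  interpret product_prob_space "\<lambda>_. M" I
    by (rule product_prob_space_power)
  interpret Q: pair_prob_space M "Pi\<^sub>M ?J (\<lambda>_. M)" ..
  have I: "insert i ?J = I"
    using assms by blast
  let ?F = "\<lambda>x. F x * \<phi> (x i)"
  have meas: "?F \<in> borel_measurable (Pi\<^sub>M I (\<lambda>_. M))"
    using \<open>i \<in> I\<close> \<phi> F by measurable
  have bound: "\<bar>?F x\<bar> \<le> B * C" if "x \<in> space (Pi\<^sub>M I (\<lambda>_. M))" for x
  proof -
    have "x i \<in> space M"
      using that \<open>i \<in> I\<close> by (auto simp: space_PiM)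
    then show ?thesis
      by (intro abs_mult_le B that C)
  qed
  have int: "integrable (Pi\<^sub>M I (\<lambda>_. M)) ?F"
    using bound meas by (intro PI.integrable_const_bound[where B = "B * C"]) (auto intro!: AE_I2)
  \<comment> \<open>This integrates coordinate \<open>i\<close> innermost; Fubini then moves it to
    the outside.\<close>
  have "integral\<^sup>L (Pi\<^sub>M (insert i ?J) (\<lambda>_. M)) ?F
      = (\<integral>x. (\<integral>y. ?F (x(i := y)) \<partial>M) \<partial>Pi\<^sub>M ?J (\<lambda>_. M))"
    by (rule product_integral_insert) (use assms(1) int I in auto)
  also have "\<dots> = (\<integral>y. (\<integral>x. ?F (x(i := y)) \<partial>Pi\<^sub>M ?J (\<lambda>_. M)) \<partial>M)"
  proof (rule Q.Fubini_integral)
    have "(\<lambda>(y, x). ?F (x(i := y))) \<in> borel_measurable (M \<Otimes>\<^sub>M Pi\<^sub>M ?J (\<lambda>_. M))"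
      using measurable_compose[OF measurable_update_power[OF \<open>i \<in> I\<close>] meas]
      by (simp add: split_beta')
    then show "integrable (M \<Otimes>\<^sub>M Pi\<^sub>M ?J (\<lambda>_. M)) (\<lambda>(y, x). ?F (x(i := y)))"
      by (intro Q.P.integrable_const_bound[where B = "B * C"])
        (auto intro!: AE_I2 bound update_in_space_power assms
          simp: space_pair_measure simp del: fun_upd_apply abs_mult)
  qed
  also have "\<dots> = (\<integral>y. coordinate_mean M I F i y * \<phi> y \<partial>M)"
    unfolding coordinate_mean_def by simp
  finally show ?thesis
    by (simp only: I)
qed

lemma integral_coordinate_mean:
  assumes "finite I" "i \<in> I" "F \<in> borel_measurable (Pi\<^sub>M I (\<lambda>_. M))"
    and "\<And>x. x \<in> space (Pi\<^sub>M I (\<lambda>_. M)) \<Longrightarrow> \<bar>F x\<bar> \<le> B"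
  shows "(\<integral>y. coordinate_mean M I F i y \<partial>M) = (\<integral>x. F x \<partial>Pi\<^sub>M I (\<lambda>_. M))"
  using integral_mult_component[OF assms, of "\<lambda>_. 1" 1] by simp

text \<open>Bessel's inequality for the orthogonal family \<open>E[F | x i] - E F\<close>: expand
  \<open>0 \<le> E (F - E F - Z)\<^sup>2\<close>, where \<open>Z\<close> is the sum of the family.\<close>

lemma variance_ge_sum_variance_coordinate_mean:
  fixes F :: "('i \<Rightarrow> 'a) \<Rightarrow> real"
  assumes "finite I"
    and F: "F \<in> borel_measurable (Pi\<^sub>M I (\<lambda>_. M))"
    and B: "\<And>x. x \<in> space (Pi\<^sub>M I (\<lambda>_. M)) \<Longrightarrow> \<bar>F x\<bar> \<le> B"
  shows "(\<Sum>i\<in>I. variance (coordinate_mean M I F i))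
    \<le> prob_space.variance (Pi\<^sub>M I (\<lambda>_. M)) F"
proof -
  let ?P = "Pi\<^sub>M I (\<lambda>_. M)"
  interpret P: prob_space ?P
    by (rule prob_space_power)
  define e where "e = P.expectation F"
  define g where "g i y = coordinate_mean M I F i y - e" for i y
  define Z where "Z x = (\<Sum>i\<in>I. g i (x i))" for x
  have exp_cm: "expectation (coordinate_mean M I F i) = e" if "i \<in> I" for i
    using integral_coordinate_mean[OF \<open>finite I\<close> that F B] by (simp add: e_def)
  have g_meas [measurable]: "g i \<in> borel_measurable M" if "i \<in> I" for i
    unfolding g_def using that F by measurable
  have g_bound: "\<bar>g i y\<bar> \<le> B + \<bar>e\<bar>" if "i \<in> I" "y \<in> space M" for i y
    using coordinate_mean_bounded[OF that(1) F B that(2)] by (simp add: g_def)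
  have g_int: "integrable M (g i)" if "i \<in> I" for i
    using that by (intro integrable_const_bound[where B = "B + \<bar>e\<bar>"]) (auto intro!: AE_I2 g_bound)
  have gg_int: "integrable M (\<lambda>y. g i y * g i y)" if "i \<in> I" for i
  proof (rule integrable_const_bound)
    show "AE y in M. norm (g i y * g i y) \<le> (B + \<bar>e\<bar>) * (B + \<bar>e\<bar>)"
      unfolding real_norm_def by (intro AE_I2 abs_mult_le g_bound that)
  qed (use that in measurable)
  have cm_int: "integrable M (coordinate_mean M I F i)" if "i \<in> I" for i
    using that F
    by (intro integrable_const_bound[where B = B]) (auto intro!: AE_I2 coordinate_mean_bounded B)
  have exp_g: "expectation (g i) = 0" if "i \<in> I" for i
    using cm_int[OF that] exp_cm[OF that] by (simp add: g_def[abs_def] prob_space)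
  have var: "variance (coordinate_mean M I F i) = expectation (\<lambda>y. g i y * g i y)" if "i \<in> I" for i
    by (simp add: g_def exp_cm[OF that] power2_eq_square)
  have space_comp: "x i \<in> space M" if "x \<in> space ?P" "i \<in> I" for x i
    using that by (auto simp: space_PiM)
  have gi_meas [measurable]: "(\<lambda>x. g i (x i)) \<in> borel_measurable ?P" if "i \<in> I" for i
    using that by measurable
  have F_int: "integrable ?P F"
    using F B by (intro P.integrable_const_bound[where B = B]) (auto intro!: AE_I2)
  have FF_int: "integrable ?P (\<lambda>x. (F x - e) * (F x - e))"
  proof (rule P.integrable_const_bound)
    have "\<bar>F x - e\<bar> \<le> B + \<bar>e\<bar>" if "x \<in> space ?P" for x
      using B[OF that] by simp
    then show "AE x in ?P. norm ((F x - e) * (F x - e)) \<le> (B + \<bar>e\<bar>) * (B + \<bar>e\<bar>)"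
      unfolding real_norm_def by (intro AE_I2 abs_mult_le)
  qed (use F in measurable)
  have Fg_int: "integrable ?P (\<lambda>x. F x * g i (x i))" if "i \<in> I" for i
    by (rule P.integrable_const_bound[where B = "B * (B + \<bar>e\<bar>)"])
      (use F that in \<open>auto intro!: AE_I2 abs_mult_le g_bound B space_comp\<close>)
  have gi_int: "integrable ?P (\<lambda>x. g i (x i))" if "i \<in> I" for i
    by (rule P.integrable_const_bound[where B = "B + \<bar>e\<bar>"])
      (use that in \<open>auto intro!: AE_I2 g_bound space_comp\<close>)
  have gij_int: "integrable ?P (\<lambda>x. g i (x i) * g j (x j))" if "i \<in> I" "j \<in> I" for i j
    by (rule P.integrable_const_bound[where B = "(B + \<bar>e\<bar>) * (B + \<bar>e\<bar>)"])
      (use that in \<open>auto intro!: AE_I2 abs_mult_le g_bound space_comp\<close>)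
  \<comment> \<open>The constant \<open>e\<close> drops out twice because \<open>g i\<close> has
    mean zero: first from \<open>F - e\<close>, then from the coordinate mean, which is
    \<open>g i + e\<close>.\<close>
  have Fg: "P.expectation (\<lambda>x. (F x - e) * g i (x i)) = expectation (\<lambda>y. g i y * g i y)"
    if "i \<in> I" for i
  proof -
    have "P.expectation (\<lambda>x. (F x - e) * g i (x i))
        = P.expectation (\<lambda>x. F x * g i (x i)) - e * P.expectation (\<lambda>x. g i (x i))"
      using Fg_int[OF that] gi_int[OF that] by (simp add: algebra_simps)
    also have "P.expectation (\<lambda>x. g i (x i)) = 0"
      using integral_power_component[OF that g_meas[OF that]] exp_g[OF that] by simp
    also have "P.expectation (\<lambda>x. F x * g i (x i))
        = expectation (\<lambda>y. coordinate_mean M I F i y * g i y)"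
      using that by (intro integral_mult_component[where B = B and C = "B + \<bar>e\<bar>"] assms g_bound) auto
    also have "\<dots> = expectation (\<lambda>y. g i y * g i y + e * g i y)"
      by (simp add: g_def algebra_simps)
    also have "\<dots> = expectation (\<lambda>y. g i y * g i y)"
      using gg_int[OF that] g_int[OF that] exp_g[OF that] by simp
    finally show ?thesis
      by simp
  qed
  have gij: "P.expectation (\<lambda>x. g i (x i) * g j (x j))
      = (if i = j then expectation (\<lambda>y. g i y * g i y) else 0)" if "i \<in> I" "j \<in> I" for i j
  proof (cases "i = j")
    case True
    then show ?thesis
      using integral_power_component[of i I "\<lambda>y. g i y * g i y"] that by simp
  next
    case False
    have "P.expectation (\<lambda>x. g i (x i) * g j (x j))
        = expectation (\<lambda>y. coordinate_mean M I (\<lambda>x. g i (x i)) j y * g j y)"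
      using that
      by (intro integral_mult_component[where B = "B + \<bar>e\<bar>" and C = "B + \<bar>e\<bar>"] assms g_bound)
        (auto intro: space_comp)
    \<comment> \<open>Fixing coordinate \<open>j\<close> does not touch \<open>x i\<close>, so this
      coordinate mean is the mean of \<open>g i\<close>, which is zero. This is the orthogonality of
      the family.\<close>
    also have "coordinate_mean M I (\<lambda>x. g i (x i)) j = (\<lambda>y. 0)"
      using False that integral_power_component[of i "I - {j}" "g i"] exp_g
      by (simp add: coordinate_mean_def fun_eq_iff)
    finally show ?thesis
      using False by simp
  qed
  have FZ: "integrable ?P (\<lambda>x. (F x - e) * Z x)"
    "P.expectation (\<lambda>x. (F x - e) * Z x) = (\<Sum>i\<in>I. expectation (\<lambda>y. g i y * g i y))"
  proof -
    have int: "integrable ?P (\<lambda>x. (F x - e) * g i (x i))" if "i \<in> I" for i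
      using Fg_int[OF that] gi_int[OF that] by (simp add: algebra_simps)
    show "integrable ?P (\<lambda>x. (F x - e) * Z x)"
      using int unfolding Z_def sum_distrib_left by (rule Bochner_Integration.integrable_sum)
    show "P.expectation (\<lambda>x. (F x - e) * Z x) = (\<Sum>i\<in>I. expectation (\<lambda>y. g i y * g i y))"
      unfolding Z_def sum_distrib_left using int
      by (subst Bochner_Integration.integral_sum) (auto simp: Fg)
  qed
  have ZZ: "integrable ?P (\<lambda>x. Z x * Z x)"
    "P.expectation (\<lambda>x. Z x * Z x) = (\<Sum>i\<in>I. expectation (\<lambda>y. g i y * g i y))"
  proof -
    show "integrable ?P (\<lambda>x. Z x * Z x)"
      unfolding Z_def sum_product using gij_int
      by (intro Bochner_Integration.integrable_sum) auto
    have "P.expectation (\<lambda>x. Z x * Z x)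
        = (\<Sum>i\<in>I. \<Sum>j\<in>I. P.expectation (\<lambda>x. g i (x i) * g j (x j)))"
      unfolding Z_def sum_product using gij_int
      by (simp add: Bochner_Integration.integral_sum Bochner_Integration.integrable_sum)
    also have "\<dots> = (\<Sum>i\<in>I. expectation (\<lambda>y. g i y * g i y))"
      using \<open>finite I\<close> by (simp add: gij)
    finally show "P.expectation (\<lambda>x. Z x * Z x) = (\<Sum>i\<in>I. expectation (\<lambda>y. g i y * g i y))" .
  qed
  \<comment> \<open>By \<open>FZ\<close> and \<open>ZZ\<close>, the cross term and the square of
    \<open>Z\<close> both have as expectation the sum \<open>s\<close> of the variances, so the
    expansion is the variance of \<open>F\<close> minus \<open>2 * s\<close> plus
    \<open>s\<close>.\<close>
  have "0 \<le> P.expectation (\<lambda>x. (F x - e - Z x)\<^sup>2)"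
    by simp
  also have "(\<lambda>x. (F x - e - Z x)\<^sup>2) = (\<lambda>x. (F x - e) * (F x - e) - 2 * ((F x - e) * Z x) + Z x * Z x)"
    by (simp add: fun_eq_iff power2_eq_square algebra_simps)
  also have "P.expectation \<dots> = P.expectation (\<lambda>x. (F x - e) * (F x - e))
      - (\<Sum>i\<in>I. expectation (\<lambda>y. g i y * g i y))"
    using FF_int FZ ZZ by simp
  finally show ?thesis
    by (simp add: var[symmetric] e_def[symmetric] power2_eq_square[of "F _ - e"])
qed

end

section \<open>Relabelling of coordinates and weights of edge sets\<close>

text \<open>Distinct coordinates of an i.i.d. family are again i.i.d. With \<open>f\<close> the
  placement of a copy of the graph, this makes mean weights independent of the placement.\<close>

lemma (in prob_space) integral_PiM_reindex:
  fixes F :: "('j \<Rightarrow> 'a) \<Rightarrow> real"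
  assumes "inj_on f J" "f \<in> J \<rightarrow> K" "F \<in> borel_measurable (Pi\<^sub>M J (\<lambda>_. M))"
  shows "(\<integral>x. F (\<lambda>j\<in>J. x (f j)) \<partial>Pi\<^sub>M K (\<lambda>_. M)) = (\<integral>x. F x \<partial>Pi\<^sub>M J (\<lambda>_. M))"
proof -
  have "(\<integral>x. F x \<partial>distr (Pi\<^sub>M K (\<lambda>_. M)) (Pi\<^sub>M J (\<lambda>_. M)) (\<lambda>x. \<lambda>j\<in>J. x (f j)))
      = (\<integral>x. F (\<lambda>j\<in>J. x (f j)) \<partial>Pi\<^sub>M K (\<lambda>_. M))"
    using assms by (intro integral_distr measurable_restrict measurable_component_singleton) auto
  moreover have "distr (Pi\<^sub>M K (\<lambda>_. M)) (Pi\<^sub>M J (\<lambda>_. M)) (\<lambda>x. \<lambda>j\<in>J. x (f j)) = Pi\<^sub>M J (\<lambda>_. M)"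
    using distr_PiM_reindex[of K "\<lambda>_. M" f J] assms prob_space_axioms by simp
  ultimately show ?thesis
    by simp
qed

lemma nsets_2_Min_Max:
  fixes e :: "nat set"
  assumes "e \<in> nsets V 2"
  shows "Min e \<in> V" "Max e \<in> V" "Min e \<noteq> Max e" "e = {Min e, Max e}"
proof -
  obtain x y where "e = {x, y}" "x \<in> V" "y \<in> V" "x \<noteq> y"
    using assms by (rule nsets2_E)
  then show "Min e \<in> V" "Max e \<in> V" "Min e \<noteq> Max e" "e = {Min e, Max e}"
    by (auto simp: min_def max_def)
qed

lemma on_edge_cong:
  assumes "e \<in> nsets V 2" "\<And>v. v \<in> V \<Longrightarrow> x v = y v"
  shows "on_edge H x e = on_edge H y e"
  using nsets_2_Min_Max[OF assms(1)] assms(2) by (simp add: on_edge_def)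

text \<open>The map \<beta> may reverse the order of the two end points and so exchange the roles of
  \<open>Min\<close> and \<open>Max\<close>; the symmetry of \<open>H\<close> absorbs this.\<close>

lemma on_edge_image:
  assumes "e \<in> nsets V 2" "\<And>x y. H x y = H y x"
  shows "on_edge H x (\<beta> ` e) = on_edge H (\<lambda>v. x (\<beta> v)) e"
proof -
  obtain a b where e: "e = {a, b}" "a < b"
    using assms(1) unfolding ordered_nsets_2_eq by blast
  then show ?thesis
    using assms(2) by (auto simp: on_edge_def min_def max_def)
qed

lemma image_nsets_2:
  assumes "e \<in> nsets V 2" "inj_on \<beta> V" "\<beta> \<in> V \<rightarrow> W"
  shows "\<beta> ` e \<in> nsets W 2"
proof -
  obtain x y where e: "e = {x, y}" "x \<in> V" "y \<in> V" "x \<noteq> y"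
    using assms(1) by (rule nsets2_E)
  then have "\<beta> x \<noteq> \<beta> y"
    using assms(2) by (auto dest: inj_onD)
  then show ?thesis
    using e assms(3) by auto
qed

text \<open>The connection function is a parameter because two choices are needed: with
  \<open>p * H\<close> this is the conditional probability, given the points \<open>x\<close>, that
  all edges of \<open>E\<close> are present; with \<open>H\<close> it is the integrand of the vertex
  integrals.\<close>

definition edge_weight :: "('a \<Rightarrow> 'a \<Rightarrow> real) \<Rightarrow> nat set set \<Rightarrow> (nat \<Rightarrow> 'a) \<Rightarrow> real" where
  "edge_weight H E x = (\<Prod>e\<in>E. on_edge H x e)"

lemma edge_weight_cong:
  assumes "E \<subseteq> nsets V 2" "\<And>v. v \<in> V \<Longrightarrow> x v = y v"
  shows "edge_weight H E x = edge_weight H E y"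
  unfolding edge_weight_def by (rule prod.cong) (use assms on_edge_cong in blast)+

lemma inj_on_image_edges:
  assumes "E \<subseteq> nsets V 2" "inj_on \<beta> V"
  shows "inj_on ((`) \<beta>) E"
proof (rule inj_on_subset)
  show "inj_on ((`) \<beta>) (Pow V)"
    using assms(2) by (rule inj_on_image_Pow)
  show "E \<subseteq> Pow V"
    using assms(1) by (auto simp: nsets_def)
qed

text \<open>Injectivity keeps distinct edges distinct, so the product can be reindexed. The
  restriction to \<open>V\<close> turns the argument into a point of the product space over
  \<open>V\<close>, as \<open>integral_PiM_reindex\<close> expects.\<close>

lemma edge_weight_image:
  assumes E: "E \<subseteq> nsets V 2" and \<beta>: "inj_on \<beta> V" and H: "\<And>x y. H x y = H y x"
  shows "edge_weight H ((`) \<beta> ` E) x = edge_weight H E (\<lambda>v\<in>V. x (\<beta> v))"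
proof -
  have "edge_weight H ((`) \<beta> ` E) x = (\<Prod>e\<in>E. on_edge H x (\<beta> ` e))"
    by (simp add: edge_weight_def prod.reindex inj_on_image_edges[OF E \<beta>])
  also have "\<dots> = edge_weight H E (\<lambda>v. x (\<beta> v))"
    unfolding edge_weight_def
    by (rule prod.cong[OF refl], rule on_edge_image[OF _ H]) (use E in blast)
  also have "\<dots> = edge_weight H E (\<lambda>v\<in>V. x (\<beta> v))"
    by (rule edge_weight_cong[OF E]) simp
  finally show ?thesis .
qed

lemma edge_weight_measurable:
  fixes H :: "'a::topological_space \<Rightarrow> 'a \<Rightarrow> real"
  assumes "E \<subseteq> nsets V 2" "sets \<mu> = sets borel"
    and H: "(\<lambda>(x, y). H x y) \<in> borel_measurable (borel \<Otimes>\<^sub>M borel)"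
  shows "edge_weight H E \<in> borel_measurable (Pi\<^sub>M V (\<lambda>_. \<mu>))"
  unfolding edge_weight_def
proof (rule borel_measurable_prod)
  fix e assume "e \<in> E"
  then have e: "Min e \<in> V" "Max e \<in> V"
    using nsets_2_Min_Max assms(1) by blast+
  have comp: "(\<lambda>x. x v) \<in> measurable (Pi\<^sub>M V (\<lambda>_. \<mu>)) borel" if "v \<in> V" for v
    using measurable_component_singleton[OF that, of "\<lambda>_. \<mu>"] assms(2)
    by (simp add: measurable_cong_sets[OF refl assms(2)])
  have "(\<lambda>x. (x (Min e), x (Max e))) \<in> measurable (Pi\<^sub>M V (\<lambda>_. \<mu>)) (borel \<Otimes>\<^sub>M borel)"
    using e by (intro measurable_Pair comp)
  from measurable_compose[OF this H]
  show "(\<lambda>x. on_edge H x e) \<in> borel_measurable (Pi\<^sub>M V (\<lambda>_. \<mu>))"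
    by (simp add: on_edge_def)
qed

lemma edge_weight_bounds:
  assumes "\<And>x y. 0 \<le> H x y" "\<And>x y. H x y \<le> 1"
  shows "0 \<le> edge_weight H E x" "edge_weight H E x \<le> 1"
  unfolding edge_weight_def on_edge_def using assms by (auto intro: prod_nonneg prod_le_1)

lemma edge_weight_scale: "edge_weight (\<lambda>x y. p * H x y) E x = p ^ card E * edge_weight H E x"
  by (simp add: edge_weight_def on_edge_def prod.distrib)

text \<open>Common edges are counted twice on the left, and each extra factor is at most 1. This is
  the nonnegative correlation of two edge sets given the points.\<close>

lemma edge_weight_union:
  assumes "finite S" "finite T" and H: "\<And>x y. 0 \<le> H x y" "\<And>x y. H x y \<le> 1"
  shows "edge_weight H S x * edge_weight H T x \<le> edge_weight H (S \<union> T) x"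
proof -
  have "edge_weight H S x * edge_weight H T x
      = edge_weight H (S \<union> T) x * edge_weight H (S \<inter> T) x"
    unfolding edge_weight_def using assms(1,2) by (rule prod.union_inter[symmetric])
  also have "\<dots> \<le> edge_weight H (S \<union> T) x * 1"
    by (intro mult_left_mono edge_weight_bounds H)
  finally show ?thesis
    by simp
qed

section \<open>Counting injections, and a factorial inequality\<close>

lemma card_injections:
  assumes "finite A" "finite B" "card A \<le> card B"
  shows "real (card {f \<in> A \<rightarrow>\<^sub>E B. inj_on f A}) = fact (card B) / fact (card B - card A)"
proof -
  have *: "real (prod ((-) n) {0..<k}) = fact n / fact (n - k)" if "k \<le> n" for n k :: nat
    using that
  proof (induction k)
    case (Suc k)
    have "n - k = Suc (n - Suc k)"
      using Suc.prems by simp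
    then have "(fact (n - k) :: real) = real (n - k) * fact (n - Suc k)"
      by (metis fact_Suc)
    then show ?case
      using Suc by simp
  qed simp
  show ?thesis
    using card_inj_on_subset_funcset[OF assms(1,2) order_refl] *[OF assms(3)] by simp
qed

text \<open>Erasing the value at \<open>a\<close> leaves an arbitrary injection of
  \<open>A - {a}\<close> into \<open>B - {b}\<close>. The result counts the placements that put a
  given vertex at a given point; it depends on neither of the two.\<close>

lemma card_injections_fixed_value:
  assumes "finite A" "finite B" "card A \<le> card B" "a \<in> A" "b \<in> B"
  shows "real (card {f \<in> A \<rightarrow>\<^sub>E B. inj_on f A \<and> f a = b})
    = fact (card B - 1) / fact (card B - card A)"
proof -
  have "bij_betw (\<lambda>f. f(a := b)) {f \<in> (A - {a}) \<rightarrow>\<^sub>E (B - {b}). inj_on f (A - {a})}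
      {f \<in> A \<rightarrow>\<^sub>E B. inj_on f A \<and> f a = b}"
  \<comment> \<open>The functions are extensional, so erasing a value means resetting it to
    \<open>undefined\<close>.\<close>
  proof (rule bij_betw_byWitness[where f' = "\<lambda>f. f(a := undefined)"])
    show "\<forall>f\<in>{f \<in> (A - {a}) \<rightarrow>\<^sub>E (B - {b}). inj_on f (A - {a})}. f(a := b, a := undefined) = f"
      by (auto simp: PiE_def extensional_def fun_eq_iff)
    show "\<forall>f\<in>{f \<in> A \<rightarrow>\<^sub>E B. inj_on f A \<and> f a = b}. f(a := undefined, a := b) = f"
      by (auto simp: fun_eq_iff)
    show "(\<lambda>f. f(a := b)) ` {f \<in> (A - {a}) \<rightarrow>\<^sub>E (B - {b}). inj_on f (A - {a})}
        \<subseteq> {f \<in> A \<rightarrow>\<^sub>E B. inj_on f A \<and> f a = b}"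
    proof (rule image_subsetI)
      fix f assume f: "f \<in> {f \<in> (A - {a}) \<rightarrow>\<^sub>E (B - {b}). inj_on f (A - {a})}"
      then have "f(a := b) \<in> A \<rightarrow>\<^sub>E B"
        using assms(4,5) by (auto simp: PiE_iff extensional_def)
      moreover have "inj_on (f(a := b)) (insert a (A - {a}))"
        using f by (intro inj_on_insert[THEN iffD2] conjI inj_on_fun_updI) (auto simp: PiE_iff)
      ultimately show "f(a := b) \<in> {f \<in> A \<rightarrow>\<^sub>E B. inj_on f A \<and> f a = b}"
        using assms(4) by (simp add: insert_absorb)
    qed
    show "(\<lambda>f. f(a := undefined)) ` {f \<in> A \<rightarrow>\<^sub>E B. inj_on f A \<and> f a = b}
        \<subseteq> {f \<in> (A - {a}) \<rightarrow>\<^sub>E (B - {b}). inj_on f (A - {a})}"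
      using assms(4) by (auto simp: PiE_iff extensional_def inj_on_def)
  qed
  then have "card {f \<in> A \<rightarrow>\<^sub>E B. inj_on f A \<and> f a = b}
      = card {f \<in> (A - {a}) \<rightarrow>\<^sub>E (B - {b}). inj_on f (A - {a})}"
    by (rule bij_betw_same_card[symmetric])
  moreover have "card A > 0"
    using assms by (auto simp: card_gt_0_iff)
  ultimately show ?thesis
    using assms card_injections[of "A - {a}" "B - {b}"] by simp
qed

text \<open>Log-convexity of the factorial, read off from the monotonicity of binomial coefficients
  in the upper argument. It brings the square of a quotient of factorials into the form of bound
  (a).\<close>

lemma fact_mult_fact_ge:
  assumes "j \<le> m"
  shows "(fact m)\<^sup>2 \<le> (fact (m + j) * fact (m - j) :: real)"
proof -
  have "real (m choose j) \<le> real ((m + j) choose j)"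
    by (intro of_nat_mono binomial_right_mono) simp
  then have "(fact m :: real) / (fact j * fact (m - j)) \<le> fact (m + j) / (fact j * fact m)"
    using assms by (simp add: binomial_fact)
  then show ?thesis
    by (simp add: field_simps power2_eq_square)
qed

section \<open>Probabilities of edge sets in the random-connection model\<close>

context random_connection_model
begin

lemma edge_probability_bounds: "0 \<le> p * H x y" "p * H x y \<le> 1"
  using p_range H_range[of x y] by (auto intro: mult_le_one)

lemma edge_weight_measurable_points:
  assumes "E \<subseteq> nsets V 2"
  shows "edge_weight H E \<in> borel_measurable (Pi\<^sub>M V (\<lambda>_. \<mu>))"
    and "edge_weight (\<lambda>x y. p * H x y) E \<in> borel_measurable (Pi\<^sub>M V (\<lambda>_. \<mu>))"
proof -
  show *: "edge_weight H E \<in> borel_measurable (Pi\<^sub>M V (\<lambda>_. \<mu>))"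
    using assms mu_sets H_measurable by (rule edge_weight_measurable)
  then show "edge_weight (\<lambda>x y. p * H x y) E \<in> borel_measurable (Pi\<^sub>M V (\<lambda>_. \<mu>))"
    by (simp add: edge_weight_scale[abs_def])
qed

lemma X_measurable: "i \<in> {1..n} \<Longrightarrow> X i \<in> borel_measurable M"
  using X_indep by (auto simp: indep_vars_def)

lemma points_measurable:
  "(\<lambda>\<omega>. \<lambda>i\<in>{1..n}. X i \<omega>) \<in> measurable M (Pi\<^sub>M {1..n} (\<lambda>_. borel))"
  by (intro measurable_restrict X_measurable)

lemma sets_power_mu: "sets (Pi\<^sub>M I (\<lambda>_. \<mu>)) = sets (Pi\<^sub>M I (\<lambda>_. borel))"
  by (intro sets_PiM_cong refl mu_sets)

lemma distr_points:
  assumes "n \<ge> 1"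
  shows "distr M (Pi\<^sub>M {1..n} (\<lambda>_. borel)) (\<lambda>\<omega>. \<lambda>i\<in>{1..n}. X i \<omega>) = Pi\<^sub>M {1..n} (\<lambda>_. \<mu>)"
proof -
  have "distr M (Pi\<^sub>M {1..n} (\<lambda>_. borel)) (\<lambda>\<omega>. \<lambda>i\<in>{1..n}. X i \<omega>)
      = Pi\<^sub>M {1..n} (\<lambda>i. distr M borel (X i))"
    using indep_vars_iff_distr_eq_PiM'[of "{1..n}" X "\<lambda>_. borel"] X_indep X_measurable assms
    by fastforce
  also have "\<dots> = Pi\<^sub>M {1..n} (\<lambda>_. \<mu>)"
    by (intro PiM_cong refl X_distr)
  finally show ?thesis .
qed

lemma expectation_points:
  fixes F :: "_ \<Rightarrow> real"
  assumes "n \<ge> 1" "F \<in> borel_measurable (Pi\<^sub>M {1..n} (\<lambda>_. \<mu>))"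
  shows "expectation (\<lambda>\<omega>. F (\<lambda>i\<in>{1..n}. X i \<omega>)) = (\<integral>x. F x \<partial>Pi\<^sub>M {1..n} (\<lambda>_. \<mu>))"
proof -
  have F: "F \<in> borel_measurable (Pi\<^sub>M {1..n} (\<lambda>_. borel))"
    using assms(2) measurable_cong_sets[OF sets_power_mu refl] by blast
  show ?thesis
    unfolding distr_points[OF assms(1), symmetric]
    by (rule integral_distr[OF points_measurable F, symmetric])
qed

lemma subalgebra_points: "subalgebra M (point_algebra M n X)"
proof -
  have "(\<lambda>\<omega>. \<omega>) \<in> measurable M (point_algebra M n X)"
    unfolding point_algebra_def by (rule measurable_vimage_algebra2) (use points_measurable in auto)
  then have "sets (point_algebra M n X) \<subseteq> sets M"
    by (auto dest!: measurable_sets simp: point_algebra_def dest: sets.sets_into_space)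
      (metis Int_absorb2 sets.sets_into_space space_vimage_algebra)
  then show ?thesis
    by (simp add: subalgebra_def point_algebra_def)
qed

lemma edges_event:
  assumes "S \<subseteq> nsets {1..n} 2"
  shows "{\<omega> \<in> space M. S \<subseteq> \<Gamma> \<omega>} \<in> events"
proof -
  have "finite S"
    using assms finite_subset finite_imp_finite_nsets by blast
  then have "{\<omega> \<in> space M. \<forall>e\<in>S. e \<in> \<Gamma> \<omega>} \<in> events"
    using assms edge_event by (intro sets.sets_Collect_finite_All) blast+
  then show ?thesis
    by (simp add: subset_iff Ball_def)
qed

text \<open>By conditional independence, the conditional probability given the points is the product
  of the edge probabilities, a function of the points alone. Its mean is an integral against the
  joint law of the points, which is a power of \<mu>.\<close>

lemma prob_edges:
  assumes "n \<ge> 1" and S: "S \<subseteq> nsets {1..n} 2"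
  shows "prob {\<omega> \<in> space M. S \<subseteq> \<Gamma> \<omega>}
    = (\<integral>x. edge_weight (\<lambda>x y. p * H x y) S x \<partial>Pi\<^sub>M {1..n} (\<lambda>_. \<mu>))"
proof -
  let ?cond = "\<lambda>A. real_cond_exp M (point_algebra M n X) (indicator A)"
  let ?A = "{\<omega> \<in> space M. \<forall>e\<in>S. e \<in> \<Gamma> \<omega>}"
  interpret C: finite_measure_subalgebra M "point_algebra M n X"
    by unfold_locales (rule subalgebra_points)
  have A: "?A = {\<omega> \<in> space M. S \<subseteq> \<Gamma> \<omega>}"
    by blast
  then have A_event: "?A \<in> events"
    using edges_event[OF S] by simp
  have fin: "finite S"
    using S finite_subset finite_imp_finite_nsets by blast
  \<comment> \<open>Since \<open>S\<close> is finite, the exceptional null sets of the single edges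
    can be merged into one.\<close>
  have "AE \<omega> in M. \<forall>e\<in>S. ?cond {\<omega> \<in> space M. e \<in> \<Gamma> \<omega>} \<omega> = p * on_edge H (\<lambda>i. X i \<omega>) e"
    using fin edge_cond_prob S by (intro AE_finite_allI) blast+
  then have AE: "AE \<omega> in M. ?cond ?A \<omega>
      = edge_weight (\<lambda>x y. p * H x y) S (\<lambda>i\<in>{1..n}. X i \<omega>)"
    using edge_cond_indep[OF S]
  proof eventually_elim
    case (elim \<omega>)
    then have "?cond ?A \<omega> = edge_weight (\<lambda>x y. p * H x y) S (\<lambda>i. X i \<omega>)"
      by (simp add: edge_weight_def on_edge_def)
    also have "\<dots> = edge_weight (\<lambda>x y. p * H x y) S (\<lambda>i\<in>{1..n}. X i \<omega>)"
      by (rule edge_weight_cong[OF S]) simp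
    finally show ?case .
  qed
  have meas: "(\<lambda>\<omega>. edge_weight (\<lambda>x y. p * H x y) S (\<lambda>i\<in>{1..n}. X i \<omega>)) \<in> borel_measurable M"
  proof (rule measurable_compose[OF points_measurable])
    show "edge_weight (\<lambda>x y. p * H x y) S \<in> borel_measurable (Pi\<^sub>M {1..n} (\<lambda>_. borel))"
      using edge_weight_measurable_points(2)[OF S] measurable_cong_sets[OF sets_power_mu refl]
      by blast
  qed
  have "prob ?A = expectation (indicator ?A)"
    using A_event by simp
  also have "\<dots> = expectation (?cond ?A)"
    by (rule C.real_cond_exp_int(2)[symmetric]) (use A_event in \<open>simp add: emeasure_eq_measure\<close>)
  also have "\<dots> = expectation (\<lambda>\<omega>. edge_weight (\<lambda>x y. p * H x y) S (\<lambda>i\<in>{1..n}. X i \<omega>))"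
    using AE meas by (intro integral_cong_AE) auto
  also have "\<dots> = (\<integral>x. edge_weight (\<lambda>x y. p * H x y) S x \<partial>Pi\<^sub>M {1..n} (\<lambda>_. \<mu>))"
    using assms(1) edge_weight_measurable_points(2)[OF S] by (rule expectation_points)
  finally show ?thesis
    by (simp only: A)
qed

text \<open>The law of total variance with respect to the points, where in the conditional variance only
  the diagonal terms are kept: given the points, indicators of edge sets are nonnegatively
  correlated.\<close>

lemma variance_sum_edge_sets:
  fixes S :: "'b \<Rightarrow> nat set set"
  assumes "n \<ge> 1" "finite B" and S: "\<And>b. b \<in> B \<Longrightarrow> S b \<subseteq> nsets {1..n} 2"
  defines "w \<equiv> \<lambda>b. edge_weight (\<lambda>x y. p * H x y) (S b)"
  shows "prob_space.variance (Pi\<^sub>M {1..n} (\<lambda>_. \<mu>)) (\<lambda>x. \<Sum>b\<in>B. w b x)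
      + (\<Sum>b\<in>B. \<integral>x. w b x - (w b x)\<^sup>2 \<partial>Pi\<^sub>M {1..n} (\<lambda>_. \<mu>))
    \<le> variance (\<lambda>\<omega>. \<Sum>b\<in>B. of_bool (S b \<subseteq> \<Gamma> \<omega>))"
proof -
  let ?P = "Pi\<^sub>M {1..n} (\<lambda>_. \<mu>)"
  let ?q = "\<lambda>x y. p * H x y"
  interpret mu: prob_space \<mu>
    by (rule mu_prob)
  interpret P: prob_space ?P
    by (rule mu.prob_space_power)
  define u where "u b \<omega> = (of_bool (S b \<subseteq> \<Gamma> \<omega>) :: real)" for b \<omega>
  have ind: "integrable M (\<lambda>\<omega>. of_bool (T \<subseteq> \<Gamma> \<omega>) :: real)"
      "expectation (\<lambda>\<omega>. of_bool (T \<subseteq> \<Gamma> \<omega>)) = P.expectation (edge_weight ?q T)"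
    if "T \<subseteq> nsets {1..n} 2" for T
  proof -
    have eq: "of_bool (T \<subseteq> \<Gamma> \<omega>) = (indicator {\<omega> \<in> space M. T \<subseteq> \<Gamma> \<omega>} \<omega> :: real)"
      if "\<omega> \<in> space M" for \<omega>
      using that by (simp add: indicator_def)
    show "integrable M (\<lambda>\<omega>. of_bool (T \<subseteq> \<Gamma> \<omega>) :: real)"
      using edges_event[OF that] by (subst Bochner_Integration.integrable_cong[OF refl eq]) (auto simp: emeasure_eq_measure)
    have "expectation (\<lambda>\<omega>. of_bool (T \<subseteq> \<Gamma> \<omega>)) = prob {\<omega> \<in> space M. T \<subseteq> \<Gamma> \<omega>}"
      using edges_event[OF that] by (subst Bochner_Integration.integral_cong[OF refl eq]) auto
    then show "expectation (\<lambda>\<omega>. of_bool (T \<subseteq> \<Gamma> \<omega>)) = P.expectation (edge_weight ?q T)"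
      using prob_edges[OF \<open>n \<ge> 1\<close> that] by simp
  qed
  have S_Un: "S b \<union> S c \<subseteq> nsets {1..n} 2" if "b \<in> B" "c \<in> B" for b c
    using S that by blast
  \<comment> \<open>A product of indicators is the indicator for the union, so second moments are
    again probabilities of edge sets.\<close>
  have uu: "u b \<omega> * u c \<omega> = of_bool (S b \<union> S c \<subseteq> \<Gamma> \<omega>)" for b c \<omega>
    by (simp add: u_def)
  have u_int: "integrable M (u b)" "expectation (u b) = P.expectation (w b)" if "b \<in> B" for b
    using ind[OF S[OF that]] by (simp_all add: u_def[abs_def] w_def)
  have uu_int: "integrable M (\<lambda>\<omega>. u b \<omega> * u c \<omega>)"
      "expectation (\<lambda>\<omega>. u b \<omega> * u c \<omega>) = P.expectation (edge_weight ?q (S b \<union> S c))"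
    if "b \<in> B" "c \<in> B" for b c
    using ind[OF S_Un[OF that]] by (simp_all only: uu)
  have q_int: "integrable ?P (edge_weight ?q T)" if "T \<subseteq> nsets {1..n} 2" for T
    using edge_weight_measurable_points(2)[OF that]
    by (intro P.integrable_const_bound[where B = 1])
      (auto intro!: AE_I2 abs_leI edge_weight_bounds edge_probability_bounds
        intro: order_trans[of _ 0] simp: edge_weight_bounds(1)[OF edge_probability_bounds])
  have w_int: "integrable ?P (w b)" if "b \<in> B" for b
    unfolding w_def using S[OF that] by (rule q_int)
  have w_meas: "w b \<in> borel_measurable ?P" if "b \<in> B" for b
    using w_int[OF that] by simp
  have w_bounds: "0 \<le> w b x" "w b x \<le> 1" for b x
    unfolding w_def by (intro edge_weight_bounds edge_probability_bounds)+
  have ww_int: "integrable ?P (\<lambda>x. w b x * w c x)" if "b \<in> B" "c \<in> B" for b c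
  proof (rule P.integrable_const_bound)
    show "AE x in ?P. norm (w b x * w c x) \<le> 1 * 1"
      unfolding real_norm_def using w_bounds by (intro AE_I2 abs_mult_le) auto
  qed (use w_meas that in measurable)
  have E_N: "expectation (\<lambda>\<omega>. \<Sum>b\<in>B. u b \<omega>) = P.expectation (\<lambda>x. \<Sum>b\<in>B. w b x)"
    using u_int w_int by simp
  have E_NN: "integrable M (\<lambda>\<omega>. (\<Sum>b\<in>B. u b \<omega>)\<^sup>2)"
    "expectation (\<lambda>\<omega>. (\<Sum>b\<in>B. u b \<omega>)\<^sup>2)
      = (\<Sum>b\<in>B. \<Sum>c\<in>B. P.expectation (edge_weight ?q (S b \<union> S c)))"
    using uu_int unfolding power2_eq_square sum_product
    by (simp_all add: Bochner_Integration.integral_sum Bochner_Integration.integrable_sum)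
  have E_WW: "integrable ?P (\<lambda>x. (\<Sum>b\<in>B. w b x)\<^sup>2)"
    "P.expectation (\<lambda>x. (\<Sum>b\<in>B. w b x)\<^sup>2)
      = (\<Sum>b\<in>B. \<Sum>c\<in>B. P.expectation (\<lambda>x. w b x * w c x))"
    using ww_int unfolding power2_eq_square sum_product
    by (simp_all add: Bochner_Integration.integral_sum Bochner_Integration.integrable_sum)
  \<comment> \<open>Here and in \<open>var_N\<close> the same squared mean is subtracted, so that
    only the second moments remain to be compared.\<close>
  have var_W: "P.variance (\<lambda>x. \<Sum>b\<in>B. w b x)
      = (\<Sum>b\<in>B. \<Sum>c\<in>B. P.expectation (\<lambda>x. w b x * w c x)) - (P.expectation (\<lambda>x. \<Sum>b\<in>B. w b x))\<^sup>2"
    using w_int E_WW by (subst P.variance_eq) auto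
  have var_N: "variance (\<lambda>\<omega>. \<Sum>b\<in>B. u b \<omega>)
      = (\<Sum>b\<in>B. \<Sum>c\<in>B. P.expectation (edge_weight ?q (S b \<union> S c)))
        - (P.expectation (\<lambda>x. \<Sum>b\<in>B. w b x))\<^sup>2"
    using u_int E_NN by (subst variance_eq) (auto simp: E_N)
  \<comment> \<open>Spreading the diagonal sum over all pairs allows a comparison pair by
    pair.\<close>
  have diag: "(\<Sum>b\<in>B. P.expectation (\<lambda>x. w b x - (w b x)\<^sup>2))
      = (\<Sum>b\<in>B. \<Sum>c\<in>B. if c = b then P.expectation (\<lambda>x. w b x - (w b x)\<^sup>2) else 0)"
    using \<open>finite B\<close> by simp
  have "P.expectation (\<lambda>x. w b x * w c x)
      + (if c = b then P.expectation (\<lambda>x. w b x - (w b x)\<^sup>2) else 0)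
      \<le> P.expectation (edge_weight ?q (S b \<union> S c))" if "b \<in> B" "c \<in> B" for b c
  proof (cases "c = b")
    \<comment> \<open>On the diagonal equality holds: the union is \<open>S b\<close>, and the added
      term replaces the square of \<open>w b\<close> by \<open>w b\<close>.\<close>
    case True
    then show ?thesis
      using w_int[OF that(1)] ww_int[OF that(1) that(1)] by (simp add: power2_eq_square w_def)
  next
    case False
    have "finite (S b)" "finite (S c)"
      using S that finite_subset finite_imp_finite_nsets finite_atLeastAtMost by metis+
    then have "P.expectation (\<lambda>x. w b x * w c x) \<le> P.expectation (edge_weight ?q (S b \<union> S c))"
      unfolding w_def
      by (intro integral_mono ww_int[OF that, unfolded w_def] q_int S_Un that
          edge_weight_union edge_probability_bounds)
    then show ?thesis
      using False by simp
  qed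
  then have "(\<Sum>b\<in>B. \<Sum>c\<in>B. P.expectation (\<lambda>x. w b x * w c x))
      + (\<Sum>b\<in>B. P.expectation (\<lambda>x. w b x - (w b x)\<^sup>2))
      \<le> (\<Sum>b\<in>B. \<Sum>c\<in>B. P.expectation (edge_weight ?q (S b \<union> S c)))"
    unfolding diag sum.distrib[symmetric] by (intro sum_mono)
  then show ?thesis
    using var_W var_N by (simp add: u_def)
qed

end

section \<open>Lower bounds for the variance of the subgraph count\<close>

lemma (in prob_space) variance_add_mult:
  fixes f :: "'a \<Rightarrow> real"
  assumes "integrable M f"
  shows "variance (\<lambda>x. a + b * f x) = b\<^sup>2 * variance f"
proof -
  have "variance (\<lambda>x. a + b * f x) = expectation (\<lambda>x. b\<^sup>2 * (f x - expectation f)\<^sup>2)"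
    using assms by (simp add: prob_space right_diff_distrib[symmetric] power_mult_distrib)
  then show ?thesis
    by simp
qed

lemma prod_of_bool_mem:
  assumes "finite A"
  shows "(\<Prod>e\<in>A. of_bool (f e \<in> B)) = (of_bool (f ` A \<subseteq> B) :: real)"
  using assms by (induction A rule: finite_induct) auto

lemma sum_of_bool_mult:
  assumes "finite A"
  shows "(\<Sum>x\<in>A. of_bool (P x) * c) = real (card {x \<in> A. P x}) * c"
  using assms by (simp add: sum_distrib_right[symmetric] Collect_conj_eq)

context random_connection_model
begin

lemma space_mu: "space \<mu> = UNIV"
  using sets_eq_imp_space_eq[OF mu_sets] by simp

lemma edge_weight_abs_le:
  "\<bar>edge_weight H E x\<bar> \<le> 1" "\<bar>edge_weight (\<lambda>x y. p * H x y) E x\<bar> \<le> 1"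
  by (simp_all add: edge_weight_bounds H_range edge_probability_bounds)

lemma integrable_coordinate_mean_edge_weight:
  assumes "E \<subseteq> nsets V 2" "l \<in> V"
  shows "integrable \<mu> (coordinate_mean \<mu> V (edge_weight H E) l)"
proof -
  interpret mu: prob_space \<mu>
    by (rule mu_prob)
  note meas = edge_weight_measurable_points(1)[OF assms(1)]
  show ?thesis
    by (rule mu.integrable_const_bound[where B = 1])
      (auto intro!: AE_I2 mu.coordinate_mean_bounded mu.coordinate_mean_measurable
        assms meas edge_weight_abs_le)
qed

text \<open>If the copy uses point \<open>i\<close>, then exactly one vertex \<open>l\<close> sits
  there, and relabelling by \<beta> turns the other points of the copy into the other vertices. If
  it does not, the value \<open>y\<close> has no influence. Injectivity leaves at most one nonzero
  term in the sum.\<close>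

lemma coordinate_mean_copy:
  assumes E: "E \<subseteq> nsets V 2" and \<beta>: "\<beta> \<in> V \<rightarrow> {1..n}" "inj_on \<beta> V" and "finite V"
  shows "coordinate_mean \<mu> {1..n} (edge_weight (\<lambda>x y. p * H x y) ((`) \<beta> ` E)) i y
    = p ^ card E * ((\<Sum>l\<in>V. of_bool (\<beta> l = i) * coordinate_mean \<mu> V (edge_weight H E) l y)
      + of_bool (i \<notin> \<beta> ` V) * (\<integral>x. edge_weight H E x \<partial>Pi\<^sub>M V (\<lambda>_. \<mu>)))"
proof -
  let ?I = "{1..n} - {i}"
  interpret mu: prob_space \<mu>
    by (rule mu_prob)
  have w: "edge_weight (\<lambda>x y. p * H x y) ((`) \<beta> ` E) x
      = p ^ card E * edge_weight H E (\<lambda>v\<in>V. x (\<beta> v))" for x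
    using edge_weight_image[OF E \<beta>(2), of "\<lambda>x y. p * H x y"] H_sym
    by (simp add: edge_weight_scale)
  show ?thesis
  proof (cases "i \<in> \<beta> ` V")
    case True
    then obtain l where l: "l \<in> V" "\<beta> l = i"
      by blast
    \<comment> \<open>Only \<open>l\<close> is mapped to \<open>i\<close>, so inserting
      \<open>y\<close> at \<open>i\<close> before pulling back along \<beta> equals inserting it at
      \<open>l\<close> afterwards.\<close>
    have "edge_weight H E (\<lambda>v\<in>V. (x(i := y)) (\<beta> v))
        = edge_weight H E ((\<lambda>v\<in>V - {l}. x (\<beta> v))(l := y))" for x
      by (rule edge_weight_cong[OF E]) (use l \<beta>(2) in \<open>auto dest: inj_onD\<close>)
    then have "coordinate_mean \<mu> {1..n} (edge_weight (\<lambda>x y. p * H x y) ((`) \<beta> ` E)) i y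
        = p ^ card E * (\<integral>x. edge_weight H E ((\<lambda>v\<in>V - {l}. x (\<beta> v))(l := y)) \<partial>Pi\<^sub>M ?I (\<lambda>_. \<mu>))"
      by (simp add: coordinate_mean_def w)
    also have "(\<integral>x. edge_weight H E ((\<lambda>v\<in>V - {l}. x (\<beta> v))(l := y)) \<partial>Pi\<^sub>M ?I (\<lambda>_. \<mu>))
        = coordinate_mean \<mu> V (edge_weight H E) l y"
      unfolding coordinate_mean_def
    proof (rule mu.integral_PiM_reindex[where F = "\<lambda>z. edge_weight H E (z(l := y))"])
      show "inj_on \<beta> (V - {l})"
        using \<beta>(2) by (rule inj_on_subset) blast
      show "\<beta> \<in> V - {l} \<rightarrow> ?I"
        using \<beta> l by (auto dest: inj_onD)
      have "integrable (Pi\<^sub>M (V - {l}) (\<lambda>_. \<mu>)) (\<lambda>z. edge_weight H E (z(l := y)))"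
        by (rule mu.integrable_power_update[OF l(1) edge_weight_measurable_points(1)[OF E]
              edge_weight_abs_le(1)]) (simp add: space_mu)
      then show "(\<lambda>z. edge_weight H E (z(l := y))) \<in> borel_measurable (Pi\<^sub>M (V - {l}) (\<lambda>_. \<mu>))"
        by simp
    qed
    also have "\<dots> = (\<Sum>v\<in>V. of_bool (\<beta> v = i) * coordinate_mean \<mu> V (edge_weight H E) v y)"
    proof -
      have "(\<Sum>v\<in>V. of_bool (\<beta> v = i) * coordinate_mean \<mu> V (edge_weight H E) v y)
          = (\<Sum>v\<in>V. if v = l then coordinate_mean \<mu> V (edge_weight H E) v y else 0)"
        by (rule sum.cong[OF refl]) (use l \<beta>(2) in \<open>auto dest: inj_onD\<close>)
      then show ?thesis
        using \<open>finite V\<close> l(1) by simp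
    qed
    finally show ?thesis
      using True by simp
  next
    case False
    then have "edge_weight H E (\<lambda>v\<in>V. (x(i := y)) (\<beta> v)) = edge_weight H E (\<lambda>v\<in>V. x (\<beta> v))" for x
      by (intro edge_weight_cong[OF E]) auto
    then have "coordinate_mean \<mu> {1..n} (edge_weight (\<lambda>x y. p * H x y) ((`) \<beta> ` E)) i y
        = p ^ card E * (\<integral>x. edge_weight H E (\<lambda>v\<in>V. x (\<beta> v)) \<partial>Pi\<^sub>M ?I (\<lambda>_. \<mu>))"
      by (simp add: coordinate_mean_def w)
    also have "(\<integral>x. edge_weight H E (\<lambda>v\<in>V. x (\<beta> v)) \<partial>Pi\<^sub>M ?I (\<lambda>_. \<mu>))
        = (\<integral>x. edge_weight H E x \<partial>Pi\<^sub>M V (\<lambda>_. \<mu>))"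
      using False \<beta> by (intro mu.integral_PiM_reindex edge_weight_measurable_points(1)[OF E]) auto
    moreover have "(\<Sum>l\<in>V. of_bool (\<beta> l = i) * coordinate_mean \<mu> V (edge_weight H E) l y) = 0"
      using False by (intro sum.neutral) auto
    ultimately show ?thesis
      using False by simp
  qed
qed

lemma image_edges_subset:
  assumes "E \<subseteq> nsets V 2" "\<beta> \<in> V \<rightarrow> {1..n}" "inj_on \<beta> V"
  shows "(`) \<beta> ` E \<subseteq> nsets {1..n} 2"
  using image_nsets_2[OF _ assms(3,2)] assms(1) by blast

text \<open>Every vertex is placed at every point by equally many injections. Hence the projections
  onto the single points are, up to additive constants, one and the same multiple of the sum of
  coordinate means, and Bessel's inequality adds up \<open>n\<close> equal variances.\<close>

lemma variance_conditional_count_ge: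
  assumes E: "E \<subseteq> nsets V 2" and "finite V" "card V \<le> n"
  defines "B \<equiv> {\<beta> \<in> V \<rightarrow>\<^sub>E {1..n}. inj_on \<beta> V}"
  shows "prob_space.variance \<mu> (\<lambda>y. \<Sum>l\<in>V. coordinate_mean \<mu> V (edge_weight H E) l y)
      * (real n * (fact (n - 1) / fact (n - card V))\<^sup>2 * p ^ (2 * card E))
    \<le> prob_space.variance (Pi\<^sub>M {1..n} (\<lambda>_. \<mu>))
      (\<lambda>x. \<Sum>\<beta>\<in>B. edge_weight (\<lambda>x y. p * H x y) ((`) \<beta> ` E) x)"
proof -
  let ?w = "\<lambda>\<beta>. edge_weight (\<lambda>x y. p * H x y) ((`) \<beta> ` E)"
  let ?h = "\<lambda>y. \<Sum>l\<in>V. coordinate_mean \<mu> V (edge_weight H E) l y"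
  let ?W = "\<lambda>x. \<Sum>\<beta>\<in>B. ?w \<beta> x"
  let ?c = "fact (n - 1) / fact (n - card V) :: real"
  interpret mu: prob_space \<mu>
    by (rule mu_prob)
  have "finite B"
    unfolding B_def using \<open>finite V\<close> by (simp add: finite_PiE)
  have B: "\<beta> \<in> V \<rightarrow> {1..n}" "inj_on \<beta> V" if "\<beta> \<in> B" for \<beta>
    using that by (auto simp: B_def)
  have meas: "?w \<beta> \<in> borel_measurable (Pi\<^sub>M {1..n} (\<lambda>_. \<mu>))" if "\<beta> \<in> B" for \<beta>
    using image_edges_subset[OF E B[OF that]] by (rule edge_weight_measurable_points(2))
  have W_meas: "?W \<in> borel_measurable (Pi\<^sub>M {1..n} (\<lambda>_. \<mu>))"
    using meas by (rule borel_measurable_sum)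
  have W_bound: "\<bar>?W x\<bar> \<le> real (card B)" for x
  proof -
    have "\<bar>?W x\<bar> \<le> (\<Sum>\<beta>\<in>B. \<bar>?w \<beta> x\<bar>)"
      by (rule sum_abs)
    also have "\<dots> \<le> (\<Sum>\<beta>\<in>B. 1)"
      by (rule sum_mono) (rule edge_weight_abs_le)
    finally show ?thesis
      by simp
  qed
  have h_int: "integrable \<mu> ?h"
    using E by (intro Bochner_Integration.integrable_sum integrable_coordinate_mean_edge_weight)
  \<comment> \<open>\<open>K\<close> collects the copies that avoid point \<open>i\<close>; its
    value is irrelevant because variances ignore additive constants.\<close>
  have cm: "\<exists>K. coordinate_mean \<mu> {1..n} ?W i = (\<lambda>y. K + (p ^ card E * ?c) * ?h y)"
    if i: "i \<in> {1..n}" for i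
  proof -
    let ?K = "\<Sum>\<beta>\<in>B. of_bool (i \<notin> \<beta> ` V) * (\<integral>x. edge_weight H E x \<partial>Pi\<^sub>M V (\<lambda>_. \<mu>))"
    have count: "real (card {\<beta> \<in> B. \<beta> l = i}) = ?c" if "l \<in> V" for l
      using card_injections_fixed_value[of V "{1..n}" l i] assms(2,3) that i
      by (simp add: B_def conj_assoc)
    have "coordinate_mean \<mu> {1..n} ?W i y = p ^ card E * ?K + (p ^ card E * ?c) * ?h y" for y
    proof -
      have "coordinate_mean \<mu> {1..n} ?W i y = (\<Sum>\<beta>\<in>B. coordinate_mean \<mu> {1..n} (?w \<beta>) i y)"
        unfolding coordinate_mean_def
        by (intro Bochner_Integration.integral_sum mu.integrable_power_update[OF i meas
              edge_weight_abs_le(2)]) (simp_all add: space_mu)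
      also have "\<dots> = (\<Sum>\<beta>\<in>B. p ^ card E *
          ((\<Sum>l\<in>V. of_bool (\<beta> l = i) * coordinate_mean \<mu> V (edge_weight H E) l y)
          + of_bool (i \<notin> \<beta> ` V) * (\<integral>x. edge_weight H E x \<partial>Pi\<^sub>M V (\<lambda>_. \<mu>))))"
        using coordinate_mean_copy[OF E B \<open>finite V\<close>] by (intro sum.cong refl)
      also have "\<dots> = p ^ card E *
          ((\<Sum>\<beta>\<in>B. \<Sum>l\<in>V. of_bool (\<beta> l = i) * coordinate_mean \<mu> V (edge_weight H E) l y) + ?K)"
        by (simp only: sum_distrib_left[symmetric] sum.distrib)
      also have "(\<Sum>\<beta>\<in>B. \<Sum>l\<in>V. of_bool (\<beta> l = i) * coordinate_mean \<mu> V (edge_weight H E) l y)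
          = (\<Sum>l\<in>V. \<Sum>\<beta>\<in>B. of_bool (\<beta> l = i) * coordinate_mean \<mu> V (edge_weight H E) l y)"
        by (rule sum.swap)
      also have "\<dots> = (\<Sum>l\<in>V. ?c * coordinate_mean \<mu> V (edge_weight H E) l y)"
        by (rule sum.cong[OF refl]) (simp only: sum_of_bool_mult[OF \<open>finite B\<close>] count)
      also have "\<dots> = ?c * ?h y"
        by (rule sum_distrib_left[symmetric])
      finally show ?thesis
        by (simp only: distrib_left mult.assoc add.commute)
    qed
    then show ?thesis
      by blast
  qed
  have "mu.variance (coordinate_mean \<mu> {1..n} ?W i) = (p ^ card E * ?c)\<^sup>2 * mu.variance ?h"
    if i: "i \<in> {1..n}" for i
    using cm[OF i] mu.variance_add_mult[OF h_int] by metis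
  then have "(\<Sum>i\<in>{1..n}. mu.variance (coordinate_mean \<mu> {1..n} ?W i))
      = real n * ((p ^ card E * ?c)\<^sup>2 * mu.variance ?h)"
    by simp
  also have "\<dots> = mu.variance ?h * (real n * ?c\<^sup>2 * p ^ (2 * card E))"
    by (simp only: power_mult_distrib power_mult mult_ac)
  finally show ?thesis
    using mu.variance_ge_sum_variance_coordinate_mean[OF _ W_meas W_bound] by simp
qed

text \<open>For \<open>w\<close> between 0 and \<open>p\<close>, the conditional variance
  \<open>w - w * w\<close> of an indicator is at least \<open>(1 - p) * w\<close>, and the mean of
  \<open>w\<close> is the same for all copies.\<close>

lemma sum_conditional_variance_ge:
  assumes E: "E \<subseteq> nsets V 2" "E \<noteq> {}" and "finite V" "card V \<le> n"
  defines "B \<equiv> {\<beta> \<in> V \<rightarrow>\<^sub>E {1..n}. inj_on \<beta> V}"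
    and "w \<equiv> \<lambda>\<beta>. edge_weight (\<lambda>x y. p * H x y) ((`) \<beta> ` E)"
  shows "(1 - p) * (\<integral>x. edge_weight H E x \<partial>Pi\<^sub>M V (\<lambda>_. \<mu>)) * (fact n / fact (n - card V) * p ^ card E)
    \<le> (\<Sum>\<beta>\<in>B. \<integral>x. w \<beta> x - (w \<beta> x)\<^sup>2 \<partial>Pi\<^sub>M {1..n} (\<lambda>_. \<mu>))"
proof -
  let ?P = "Pi\<^sub>M {1..n} (\<lambda>_. \<mu>)"
  let ?m = "\<integral>x. edge_weight H E x \<partial>Pi\<^sub>M V (\<lambda>_. \<mu>)"
  interpret mu: prob_space \<mu>
    by (rule mu_prob)
  interpret P: prob_space ?P
    by (rule mu.prob_space_power)
  have "finite E"
    using E(1) \<open>finite V\<close> finite_subset finite_imp_finite_nsets by blast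
  then have card_E: "card E \<ge> 1"
    using E(2) by (simp add: Suc_le_eq card_gt_0_iff)
  have "(1 - p) * (p ^ card E * ?m) \<le> P.expectation (\<lambda>x. w \<beta> x - (w \<beta> x)\<^sup>2)" if "\<beta> \<in> B" for \<beta>
  proof -
    have \<beta>: "\<beta> \<in> V \<rightarrow> {1..n}" "inj_on \<beta> V"
      using that by (auto simp: B_def)
    have w: "w \<beta> x = p ^ card E * edge_weight H E (\<lambda>v\<in>V. x (\<beta> v))" for x
      using edge_weight_image[OF E(1) \<beta>(2), of "\<lambda>x y. p * H x y"] H_sym
      by (simp add: edge_weight_scale w_def)
    have w_bounds: "0 \<le> w \<beta> x" "w \<beta> x \<le> p" for x
    proof -
      show "0 \<le> w \<beta> x"
        unfolding w_def by (intro edge_weight_bounds edge_probability_bounds)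
      \<comment> \<open>The presence of at least one edge enters here, through
        \<open>p ^ card E\<close> being at most \<open>p\<close>.\<close>
      have "w \<beta> x \<le> p ^ 1 * 1"
        unfolding w using p_range card_E
        by (intro mult_mono power_decreasing edge_weight_bounds H_range) auto
      then show "w \<beta> x \<le> p"
        by simp
    qed
    have meas: "w \<beta> \<in> borel_measurable ?P"
      unfolding w_def using image_edges_subset[OF E(1) \<beta>] by (rule edge_weight_measurable_points(2))
    have int: "integrable ?P (w \<beta>)" "integrable ?P (\<lambda>x. w \<beta> x * w \<beta> x)"
    proof -
      show "integrable ?P (w \<beta>)"
        using meas by (rule P.integrable_const_bound[rotated]) (use w_bounds in auto)
      have "AE x in ?P. norm (w \<beta> x * w \<beta> x) \<le> p * p"
        unfolding real_norm_def using w_bounds by (intro AE_I2 abs_mult_le) auto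
      then show "integrable ?P (\<lambda>x. w \<beta> x * w \<beta> x)"
        by (rule P.integrable_const_bound) (use meas in measurable)
    qed
    have "(1 - p) * (p ^ card E * ?m) = P.expectation (\<lambda>x. (1 - p) * w \<beta> x)"
      using mu.integral_PiM_reindex[OF \<beta>(2,1) edge_weight_measurable_points(1)[OF E(1)]]
      by (simp add: w)
    also have "\<dots> \<le> P.expectation (\<lambda>x. w \<beta> x - (w \<beta> x)\<^sup>2)"
    proof (rule integral_mono)
      show "integrable ?P (\<lambda>x. w \<beta> x - (w \<beta> x)\<^sup>2)"
        using int by (simp add: power2_eq_square)
      show "(1 - p) * w \<beta> x \<le> w \<beta> x - (w \<beta> x)\<^sup>2" for x
        using mult_right_mono[OF w_bounds(2) w_bounds(1), of x]
        by (simp add: power2_eq_square algebra_simps)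
    qed (use int in simp)
    finally show ?thesis .
  qed
  then have "(\<Sum>\<beta>\<in>B. (1 - p) * (p ^ card E * ?m)) \<le> (\<Sum>\<beta>\<in>B. P.expectation (\<lambda>x. w \<beta> x - (w \<beta> x)\<^sup>2))"
    by (rule sum_mono)
  moreover have "real (card B) = fact n / fact (n - card V)"
    using card_injections[of V "{1..n}"] assms(3,4) by (simp add: B_def)
  ultimately show ?thesis
    by (simp add: mult_ac)
qed

lemma variance_subgraph_count_ge:
  assumes E: "E \<subseteq> nsets V 2" and "finite V" "n \<ge> 1"
  defines "B \<equiv> {\<beta> \<in> V \<rightarrow>\<^sub>E {1..n}. inj_on \<beta> V}"
    and "w \<equiv> \<lambda>\<beta>. edge_weight (\<lambda>x y. p * H x y) ((`) \<beta> ` E)"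
  shows "(prob_space.variance (Pi\<^sub>M {1..n} (\<lambda>_. \<mu>)) (\<lambda>x. \<Sum>\<beta>\<in>B. w \<beta> x)
      + (\<Sum>\<beta>\<in>B. \<integral>x. w \<beta> x - (w \<beta> x)\<^sup>2 \<partial>Pi\<^sub>M {1..n} (\<lambda>_. \<mu>)))
      / (real (card (automorphisms V E)))\<^sup>2
    \<le> variance (\<lambda>\<omega>. subgraph_count V E n (\<Gamma> \<omega>))"
proof -
  let ?a = "real (card (automorphisms V E))"
  let ?N = "\<lambda>\<omega>. \<Sum>\<beta>\<in>B. of_bool ((`) \<beta> ` E \<subseteq> \<Gamma> \<omega>) :: real"
  have "finite B"
    unfolding B_def using \<open>finite V\<close> by (simp add: finite_PiE)
  have S: "(`) \<beta> ` E \<subseteq> nsets {1..n} 2" if "\<beta> \<in> B" for \<beta>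
    using that by (intro image_edges_subset[OF E]) (auto simp: B_def)
  have "finite E"
    using E(1) \<open>finite V\<close> finite_subset finite_imp_finite_nsets by blast
  \<comment> \<open>The summand 0 gives the affine shape of
    \<open>variance_add_mult\<close>.\<close>
  then have count: "subgraph_count V E n (\<Gamma> \<omega>) = 0 + 1 / ?a * ?N \<omega>" for \<omega>
    by (simp add: subgraph_count_def B_def prod_of_bool_mem)
  have "integrable M ?N"
  proof (rule Bochner_Integration.integrable_sum)
    fix \<beta> assume "\<beta> \<in> B"
    have eq: "of_bool ((`) \<beta> ` E \<subseteq> \<Gamma> \<omega>)
        = (indicator {\<omega> \<in> space M. (`) \<beta> ` E \<subseteq> \<Gamma> \<omega>} \<omega> :: real)" if "\<omega> \<in> space M" for \<omega>
      using that by (simp add: indicator_def)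
    show "integrable M (\<lambda>\<omega>. of_bool ((`) \<beta> ` E \<subseteq> \<Gamma> \<omega>) :: real)"
      using edges_event[OF S[OF \<open>\<beta> \<in> B\<close>]]
      by (subst Bochner_Integration.integrable_cong[OF refl eq]) (auto simp: emeasure_eq_measure)
  qed
  then have "variance (\<lambda>\<omega>. subgraph_count V E n (\<Gamma> \<omega>)) = (1 / ?a)\<^sup>2 * variance ?N"
    unfolding count by (rule variance_add_mult)
  then show ?thesis
    using variance_sum_edge_sets[OF \<open>n \<ge> 1\<close> \<open>finite B\<close> S]
    by (simp add: w_def power_divide divide_right_mono)
qed

text \<open>Translates the variance condition of the theorem into one on \<mu>, \<open>H\<close> and
  the graph only, free of \<open>p\<close> and \<open>n\<close>.\<close>

lemma variance_vertex_integrals: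
  assumes E: "E \<subseteq> nsets V 2" and "n \<ge> 1"
  shows "variance (\<lambda>\<omega>. \<Sum>l\<in>V. vertex_integral V E \<mu> H p l (X 1 \<omega>))
    = (p ^ card E / real (card (automorphisms V E)))\<^sup>2
      * prob_space.variance \<mu> (\<lambda>y. \<Sum>l\<in>V. coordinate_mean \<mu> V (edge_weight H E) l y)"
proof -
  let ?h = "\<lambda>y. \<Sum>l\<in>V. coordinate_mean \<mu> V (edge_weight H E) l y"
  let ?c = "p ^ card E / real (card (automorphisms V E))"
  interpret mu: prob_space \<mu>
    by (rule mu_prob)
  have h_int: "integrable \<mu> ?h"
    using E by (intro Bochner_Integration.integrable_sum integrable_coordinate_mean_edge_weight)
  have eq: "(\<Sum>l\<in>V. vertex_integral V E \<mu> H p l y) = 0 + ?c * ?h y" for y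
    by (simp add: vertex_integral_def coordinate_mean_def edge_weight_def sum_distrib_left)
  have X: "X 1 \<in> borel_measurable M" "distr M borel (X 1) = \<mu>"
    using X_measurable X_distr \<open>n \<ge> 1\<close> by simp_all
  have transfer: "expectation (\<lambda>\<omega>. f (X 1 \<omega>)) = mu.expectation f"
    if "f \<in> borel_measurable \<mu>" for f :: "_ \<Rightarrow> real"
  proof -
    have "f \<in> borel_measurable borel"
      using that measurable_cong_sets[OF mu_sets refl] by blast
    then show ?thesis
      unfolding X(2)[symmetric] by (rule integral_distr[OF X(1), symmetric])
  qed
  have meas: "(\<lambda>y. 0 + ?c * ?h y) \<in> borel_measurable \<mu>"
    using h_int by simp
  have "variance (\<lambda>\<omega>. 0 + ?c * ?h (X 1 \<omega>)) = mu.variance (\<lambda>y. 0 + ?c * ?h y)"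
    \<comment> \<open>The transfer is applied twice: to the mean inside the variance, then to the
      squared deviation.\<close>
    unfolding transfer[OF meas] by (rule transfer) (use meas in measurable)
  also have "\<dots> = ?c\<^sup>2 * mu.variance ?h"
    using h_int by (rule mu.variance_add_mult)
  finally show ?thesis
    unfolding eq .
qed

text \<open>The coordinate means are nonnegative and all have this integral as their mean. If it
  were zero, they would vanish almost everywhere, and so would the variance of their sum.\<close>

lemma mean_edge_weight_pos:
  assumes E: "E \<subseteq> nsets V 2" and "finite V"
    and "prob_space.variance \<mu> (\<lambda>y. \<Sum>l\<in>V. coordinate_mean \<mu> V (edge_weight H E) l y) > 0"
  shows "(\<integral>x. edge_weight H E x \<partial>Pi\<^sub>M V (\<lambda>_. \<mu>)) > 0"
proof (rule ccontr)
  let ?P = "Pi\<^sub>M V (\<lambda>_. \<mu>)"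
  let ?h = "\<lambda>l. coordinate_mean \<mu> V (edge_weight H E) l"
  assume "\<not> (\<integral>x. edge_weight H E x \<partial>?P) > 0"
  moreover have "(\<integral>x. edge_weight H E x \<partial>?P) \<ge> 0"
    by (intro integral_nonneg_AE AE_I2 edge_weight_bounds H_range)
  ultimately have zero: "(\<integral>x. edge_weight H E x \<partial>?P) = 0"
    by simp
  interpret mu: prob_space \<mu>
    by (rule mu_prob)
  have "AE y in \<mu>. ?h l y = 0" if "l \<in> V" for l
  proof -
    have "mu.expectation (?h l) = 0"
      using mu.integral_coordinate_mean[OF \<open>finite V\<close> that edge_weight_measurable_points(1)[OF E]
          edge_weight_abs_le(1)] zero by simp
    moreover have "AE y in \<mu>. 0 \<le> ?h l y"
      unfolding coordinate_mean_def
      by (intro AE_I2 integral_nonneg_AE edge_weight_bounds H_range)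
    ultimately show ?thesis
      using integral_nonneg_eq_0_iff_AE[OF integrable_coordinate_mean_edge_weight[OF E that]]
      by simp
  qed
  then have "AE y in \<mu>. \<forall>l\<in>V. ?h l y = 0"
    using \<open>finite V\<close> by (intro AE_finite_allI)
  then have AE: "AE y in \<mu>. (\<Sum>l\<in>V. ?h l y) = 0"
    by eventually_elim simp
  then have mean: "mu.expectation (\<lambda>y. \<Sum>l\<in>V. ?h l y) = 0"
    by (rule integral_eq_zero_AE)
  have "mu.variance (\<lambda>y. \<Sum>l\<in>V. ?h l y) = 0"
    unfolding mean by (rule integral_eq_zero_AE) (use AE in eventually_elim, simp)
  then show False
    using assms(3) by simp
qed

end

section \<open>Constants uniform in \<open>n\<close>, and the conclusion\<close>

text \<open>A nonpositive exponent gives \<open>real n powr a\<close> at most 1, so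
  \<open>p n < 1 / 2\<close> from some index on; before it there are only finitely many values, each
  below 1.\<close>

lemma bounded_away_from_one:
  fixes p :: "nat \<Rightarrow> real"
  assumes "p \<lless> (\<lambda>n. real n powr a)" "a \<le> 0" and p: "\<And>n. n \<ge> 1 \<Longrightarrow> p n < 1"
  obtains \<delta> where "\<delta> > 0" "\<And>n. n \<ge> 1 \<Longrightarrow> \<delta> \<le> 1 - p n"
proof -
  have "(\<lambda>n. p n / real n powr a) \<longlonglongrightarrow> 0"
    using assms(1) by (simp add: much_less_def)
  then have "eventually (\<lambda>n. p n / real n powr a < 1 / 2) sequentially"
    by (rule order_tendstoD) simp
  then obtain N where N: "\<And>n. n \<ge> N \<Longrightarrow> p n / real n powr a < 1 / 2"
    by (auto simp: eventually_sequentially)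
  \<comment> \<open>The element \<open>1 / 2\<close> serves all indices beyond \<open>N\<close> and
    keeps the set nonempty.\<close>
  let ?\<delta> = "Min (insert (1 / 2) ((\<lambda>n. 1 - p n) ` {1..N}))"
  have "?\<delta> > 0"
    using p by (subst Min_gr_iff) auto
  moreover have "?\<delta> \<le> 1 - p n" if "n \<ge> 1" for n
  proof (cases "n \<le> N")
    case True
    then show ?thesis
      using that by (intro Min_le) auto
  next
    case False
    have pos: "real n powr a > 0" and "real n powr a \<le> 1"
      using that \<open>a \<le> 0\<close> powr_mono[of a 0 "real n"] by auto
    then have "p n < 1 / 2"
      using N[of n] False by (simp add: field_simps)
    moreover have "?\<delta> \<le> 1 / 2"
      by (rule Min_le) auto
    ultimately show ?thesis
      by linarith
  qed
  ultimately show ?thesis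
    by (rule that)
qed

theorem proposition7p7:
  fixes k :: nat
    and E :: "nat set set"
    and \<mu> :: "(real ^ 'd) measure"
    and H :: "real ^ 'd \<Rightarrow> real ^ 'd \<Rightarrow> real"
    and p :: "nat \<Rightarrow> real"
    and M :: "nat \<Rightarrow> 'w measure"
    and X :: "nat \<Rightarrow> nat \<Rightarrow> 'w \<Rightarrow> real ^ 'd"
    and \<Gamma> :: "nat \<Rightarrow> 'w \<Rightarrow> nat set set"
  assumes "k \<ge> 2"
    and "simple_graph {1..k} E"
    and "connected_graph {1..k} E"
    and "strongly_balanced {1..k} E"
    and "\<And>n. n \<ge> 1 \<Longrightarrow> random_connection_model (M n) \<mu> H (p n) n (X n) (\<Gamma> n)"
    and "\<And>n. n \<ge> 1 \<Longrightarrow>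
      prob_space.variance (M n)
        (\<lambda>\<omega>. \<Sum>l=1..k. vertex_integral {1..k} E \<mu> H (p n) l (X n 1 \<omega>)) > 0"
  shows
    "((\<lambda>n. real n powr (- (real k - 1) / real (card E))) \<lless> p \<longrightarrow>
       (\<exists>C>0. \<forall>n\<ge>2 * k - 1.
          prob_space.variance (M n) (\<lambda>\<omega>. subgraph_count {1..k} E n (\<Gamma> n \<omega>))
          \<ge> C / (real (card (automorphisms {1..k} E)))\<^sup>2
              * (fact n / fact (n + 1 - 2 * k)) * p n ^ (2 * card E)))
     \<and>
     (p \<lless> (\<lambda>n. real n powr (- (real k - 1) / real (card E))) \<longrightarrow>
       (\<exists>C>0. \<forall>n\<ge>2 * k - 1.
          prob_space.variance (M n) (\<lambda>\<omega>. subgraph_count {1..k} E n (\<Gamma> n \<omega>))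
          \<ge> C / (real (card (automorphisms {1..k} E)))\<^sup>2
              * (fact n / fact (n - k)) * p n ^ card E))"
proof -
  let ?V = "{1..k}"
  let ?a = "real (card (automorphisms ?V E))"
  \<comment> \<open>Neither \<open>v\<close> nor \<open>m\<close> involves \<open>n\<close>:
    \<open>v\<close> is the constant of (a), and \<open>m\<close> is a factor of the constant of
    (b).\<close>
  define v where "v = prob_space.variance \<mu> (\<lambda>y. \<Sum>l\<in>?V. coordinate_mean \<mu> ?V (edge_weight H E) l y)"
  define m where "m = (\<integral>x. edge_weight H E x \<partial>Pi\<^sub>M ?V (\<lambda>_. \<mu>))"
  have E: "E \<subseteq> nsets ?V 2"
    using assms(2) by (simp add: simple_graph_def)
  have "E \<noteq> {}"
  proof
    assume "E = {}"
    \<comment> \<open>Since \<open>k\<close> is at least 2, vertices 1 and 2 must be joined by a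
      path, but the closure of the empty relation is the identity.\<close>
    have "(1, 2) \<in> {(x, y). {x, y} \<in> E}\<^sup>*"
      using assms(1,3) by (auto simp: connected_graph_def)
    with \<open>E = {}\<close> show False
      by simp
  qed
  have "v > 0"
  proof -
    \<comment> \<open>As \<open>v\<close> is free of \<open>n\<close>, the model with a single point
      already yields its positivity.\<close>
    interpret random_connection_model "M 1" \<mu> H "p 1" 1 "X 1" "\<Gamma> 1"
      using assms(5) by simp
    have "0 < (p 1 ^ card E / ?a)\<^sup>2 * v"
      using assms(6)[of 1] variance_vertex_integrals[OF E] by (simp add: v_def)
    then show ?thesis
      by (simp add: zero_less_mult_iff)
  qed
  have "m > 0"
  proof -
    interpret random_connection_model "M 1" \<mu> H "p 1" 1 "X 1" "\<Gamma> 1"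
      using assms(5) by simp
    show ?thesis
      unfolding m_def using \<open>v > 0\<close> by (intro mean_edge_weight_pos E) (auto simp: v_def)
  qed
  \<comment> \<open>Both bounds for each fixed \<open>n\<close>; afterwards only
    \<open>1 - p n\<close> remains to be bounded uniformly.\<close>
  have lower: "v * (fact n / fact (n + 1 - 2 * k) * p n ^ (2 * card E)) / ?a\<^sup>2
      \<le> prob_space.variance (M n) (\<lambda>\<omega>. subgraph_count ?V E n (\<Gamma> n \<omega>))"
    "(1 - p n) * m * (fact n / fact (n - k) * p n ^ card E) / ?a\<^sup>2
      \<le> prob_space.variance (M n) (\<lambda>\<omega>. subgraph_count ?V E n (\<Gamma> n \<omega>))"
    if n: "n \<ge> 2 * k - 1" for n
  proof -
    have "n \<ge> 1" "k \<le> n"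
      using n assms(1) by auto
    interpret random_connection_model "M n" \<mu> H "p n" n "X n" "\<Gamma> n"
      using \<open>n \<ge> 1\<close> by (rule assms(5))
    interpret mu: prob_space \<mu>
      by (rule mu_prob)
    interpret P: prob_space "Pi\<^sub>M {1..n} (\<lambda>_. \<mu>)"
      by (rule mu.prob_space_power)
    let ?B = "{\<beta> \<in> ?V \<rightarrow>\<^sub>E {1..n}. inj_on \<beta> ?V}"
    let ?w = "\<lambda>\<beta>. edge_weight (\<lambda>x y. p n * H x y) ((`) \<beta> ` E)"
    let ?VW = "P.variance (\<lambda>x. \<Sum>\<beta>\<in>?B. ?w \<beta> x)"
    let ?D = "\<Sum>\<beta>\<in>?B. P.expectation (\<lambda>x. ?w \<beta> x - (?w \<beta> x)\<^sup>2)"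
    note total = variance_subgraph_count_ge[OF E finite_atLeastAtMost \<open>n \<ge> 1\<close>]
    have VW: "v * (real n * (fact (n - 1) / fact (n - k))\<^sup>2 * p n ^ (2 * card E)) \<le> ?VW"
      using variance_conditional_count_ge[OF E] \<open>k \<le> n\<close> by (simp add: v_def)
    have D: "(1 - p n) * m * (fact n / fact (n - k) * p n ^ card E) \<le> ?D"
      using sum_conditional_variance_ge[OF E \<open>E \<noteq> {}\<close>] \<open>k \<le> n\<close> by (simp add: m_def)
    \<comment> \<open>With both summands nonnegative, either one alone is a lower bound of the
      total.\<close>
    have "?VW \<ge> 0"
      by simp
    have "(1 - p n) * m * (fact n / fact (n - k) * p n ^ card E) \<ge> 0"
      using p_range \<open>m > 0\<close> by simp
    then have "?D \<ge> 0"
      using D by linarith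
    have "fact n / fact (n + 1 - 2 * k) \<le> real n * (fact (n - 1) / fact (n - k))\<^sup>2"
    proof -
      \<comment> \<open>\<open>fact_mult_fact_ge\<close> with \<open>m = n - k\<close> and
        \<open>j = k - 1\<close>. The condition \<open>n \<ge> 2 * k - 1\<close> says exactly that
        \<open>j \<le> m\<close>, and it keeps the subtraction in \<open>n + 1 - 2 * k\<close> from
        truncating.\<close>
      have "(fact (n - k) :: real)\<^sup>2 \<le> fact (n - 1) * fact (n + 1 - 2 * k)"
      proof -
        have "n - k + (k - 1) = n - 1" "n - k - (k - 1) = n + 1 - 2 * k" "k - 1 \<le> n - k"
          using n assms(1) by auto
        then show ?thesis
          using fact_mult_fact_ge[of "k - 1" "n - k"] by (simp only:)
      qed
      then have "fact n * (fact (n - k))\<^sup>2 \<le> (fact n * (fact (n - 1) * fact (n + 1 - 2 * k)) :: real)"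
        by simp
      moreover have "(fact n :: real) = real n * fact (n - 1)"
        using \<open>n \<ge> 1\<close> by (simp add: fact_reduce)
      ultimately show ?thesis
        by (simp add: field_simps power2_eq_square)
    qed
    then have "v * (fact n / fact (n + 1 - 2 * k) * p n ^ (2 * card E))
        \<le> v * (real n * (fact (n - 1) / fact (n - k))\<^sup>2 * p n ^ (2 * card E))"
      using \<open>v > 0\<close> p_range by (intro mult_left_mono mult_right_mono) auto
    with VW \<open>?D \<ge> 0\<close> have "v * (fact n / fact (n + 1 - 2 * k) * p n ^ (2 * card E)) \<le> ?VW + ?D"
      by linarith
    then show "v * (fact n / fact (n + 1 - 2 * k) * p n ^ (2 * card E)) / ?a\<^sup>2
        \<le> variance (\<lambda>\<omega>. subgraph_count ?V E n (\<Gamma> n \<omega>))"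
      using total by (meson divide_right_mono order_trans zero_le_power2)
    from D \<open>?VW \<ge> 0\<close>
    have "(1 - p n) * m * (fact n / fact (n - k) * p n ^ card E) \<le> ?VW + ?D"
      by linarith
    then show "(1 - p n) * m * (fact n / fact (n - k) * p n ^ card E) / ?a\<^sup>2
        \<le> variance (\<lambda>\<omega>. subgraph_count ?V E n (\<Gamma> n \<omega>))"
      using total by (meson divide_right_mono order_trans zero_le_power2)
  qed
  show ?thesis
  proof (intro conjI impI)
    show "\<exists>C>0. \<forall>n\<ge>2 * k - 1.
        prob_space.variance (M n) (\<lambda>\<omega>. subgraph_count ?V E n (\<Gamma> n \<omega>))
        \<ge> C / ?a\<^sup>2 * (fact n / fact (n + 1 - 2 * k)) * p n ^ (2 * card E)"
      using \<open>v > 0\<close> lower(1) by (intro exI[of _ v]) (simp add: mult_ac)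
  next
    \<comment> \<open>The upper bound on the growth of \<open>p\<close> keeps \<open>1 - p n\<close>
      above a fixed \<delta>, which gives the constant \<open>\<delta> * m\<close>.\<close>
    assume "p \<lless> (\<lambda>n. real n powr (- (real k - 1) / real (card E)))"
    moreover have "- (real k - 1) / real (card E) \<le> 0"
      using assms(1) by (intro divide_nonpos_nonneg) auto
    moreover have "p n < 1" if "n \<ge> 1" for n
      using random_connection_model.p_range(2)[OF assms(5)[OF that]] .
    ultimately obtain \<delta> where \<delta>: "\<delta> > 0" "\<And>n. n \<ge> 1 \<Longrightarrow> \<delta> \<le> 1 - p n"
      using bounded_away_from_one by blast
    have "\<delta> * m / ?a\<^sup>2 * (fact n / fact (n - k)) * p n ^ card E
        \<le> prob_space.variance (M n) (\<lambda>\<omega>. subgraph_count ?V E n (\<Gamma> n \<omega>))"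
      if n: "n \<ge> 2 * k - 1" for n
    proof -
      have "n \<ge> 1"
        using n assms(1) by simp
      then have "p n > 0"
        using random_connection_model.p_range(1) assms(5) by blast
      then have "\<delta> * (m * (fact n / fact (n - k) * p n ^ card E) / ?a\<^sup>2)
          \<le> (1 - p n) * (m * (fact n / fact (n - k) * p n ^ card E) / ?a\<^sup>2)"
        using \<delta>(2)[OF \<open>n \<ge> 1\<close>] \<open>m > 0\<close> by (intro mult_right_mono) auto
      then show ?thesis
        using lower(2)[OF n] by (simp add: mult_ac)
    qed
    then show "\<exists>C>0. \<forall>n\<ge>2 * k - 1.
        prob_space.variance (M n) (\<lambda>\<omega>. subgraph_count ?V E n (\<Gamma> n \<omega>))
        \<ge> C / ?a\<^sup>2 * (fact n / fact (n - k)) * p n ^ card E"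
      using \<delta>(1) \<open>m > 0\<close> by (intro exI[of _ "\<delta> * m"]) simp
  qed
qed

end
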